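(* Let $n\ge 3$ and $s\ge 1$ be integers. (i) For every primitive vector $\boldsymbol a=(a_1,\dots,a_n)^\intercal\in\mathbb Z_{>0}^n$ (i.e. $\gcd(a_1,\dots,a_n)=1$), $$\mathrm F_s(\boldsymbol a)\ \ge\ \vartheta_s(S_{n-1})\left(\prod_{i=1}^n a_i\right)^{\frac1{n-1}}-\sum_{i=1}^n a_i .$$ (ii) For every $\epsilon>0$ and every $\boldsymbol\alpha=(\alpha_1,\dots,\alpha_{n-1})\in\mathbb R^{n-1}$ with $0<\alpha_1\le\cdots\le\alpha_{n-1}$, there exists a primitive vector $\boldsymbol a=(a_1,\dots,a_n)\in\mathbb Z_{>0}^n$ such that $$\left|\alpha_i-\frac{a_i}{a_n}\right|<\epsilon,\qquad i=1,\dots,n-1,$$ and $$\frac{\mathrm F_s(\boldsymbol a)+\sum_{i=1}^n a_i}{(a_1\cdots a_n)^{1/(n-1)}}<\vartheta_s(S_{n-1})+\epsilon .$$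
   Context: For a primitive vector $\boldsymbol a\in\mathbb Z_{>0}^n$ and $b\in\mathbb Z$ put $P(\boldsymbol a^\intercal,b)=\{\boldsymbol x\in\mathbb R^n_{\ge 0}:\boldsymbol a^\intercal\boldsymbol x=b\}$. The $s$-Frobenius number is $$\mathrm F_s(\boldsymbol a)=\max\{b\in\mathbb Z:\ \#(P(\boldsymbol a^\intercal,b)\cap\mathbb Z^n)<s\}.$$ For a full-dimensional lattice $L\subset\mathbb R^d$ and a convex body $K\subset\mathbb R^d$ (compact, convex, nonempty interior), the $s$-covering radius is $$\mu_s(K,L)=\min\{\mu>0:\ \text{for all }\boldsymbol x\in\mathbb R^d\text{ there exist distinct }\boldsymbol y_1,\dots,\boldsymbol y_s\in L\text{ with }\boldsymbol x\in\boldsymbol y_i+\mu K\text{ for all }1\le i\le s\}.$$ The absolute $s$-inhomogeneous minimum of $K\subset\mathbb R^d$ is $$\vartheta_s(K)=\inf_L\frac{\mu_s(K,L)}{\det(L)^{1/d}},$$ the infimum being over all $d$-dimensional lattices $L\subset\mathbb R^d$. $S_{n-1}=\{\boldsymbol x\in\mathbb R^{n-1}_{\ge 0}:x_1+\cdots+x_{n-1}\le 1\}$ is the standard simplex. *)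

theory Defs
  imports Complex_Main "Jordan_Normal_Form.Determinant"
begin

text \<open>
  Points of $\mathbb{R}^d$ are elements of \<^term>\<open>carrier_vec d :: real vec set\<close>. Coordinates are
  indexed from 0, so the coordinate written $x_i$ on paper is \<open>x $ (i - 1)\<close>.
\<close>

definition integer_vecs :: "nat \<Rightarrow> real vec set" where
  "integer_vecs d = {x \<in> carrier_vec d. \<forall>i<d. x $ i \<in> \<int>}"

definition primitive_pos_vec :: "nat \<Rightarrow> int vec \<Rightarrow> bool" where
  "primitive_pos_vec n a \<longleftrightarrow>
     a \<in> carrier_vec n \<and> (\<forall>i<n. 0 < a $ i) \<and> Gcd {a $ i |i. i < n} = 1"

definition knapsack_polytope :: "int vec \<Rightarrow> int \<Rightarrow> real vec set" where
  "knapsack_polytope a b =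
     {x \<in> carrier_vec (dim_vec a).
        (\<forall>i<dim_vec a. 0 \<le> x $ i) \<and> map_vec real_of_int a \<bullet> x = real_of_int b}"

definition frobenius_number :: "nat \<Rightarrow> int vec \<Rightarrow> int" where
  "frobenius_number s a =
     (GREATEST b. card (knapsack_polytope a b \<inter> integer_vecs (dim_vec a)) < s)"

definition is_lattice_basis :: "nat \<Rightarrow> real mat \<Rightarrow> real vec set \<Rightarrow> bool" where
  "is_lattice_basis d B L \<longleftrightarrow>
     B \<in> carrier_mat d d \<and> det B \<noteq> 0 \<and> L = {B *\<^sub>v z |z. z \<in> integer_vecs d}"

definition is_lattice :: "nat \<Rightarrow> real vec set \<Rightarrow> bool" where
  "is_lattice d L \<longleftrightarrow> (\<exists>B. is_lattice_basis d B L)"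

text \<open>Well defined, since two bases of a lattice differ by a unimodular matrix.\<close>

definition lattice_det :: "nat \<Rightarrow> real vec set \<Rightarrow> real" where
  "lattice_det d L = (THE D. \<exists>B. is_lattice_basis d B L \<and> D = \<bar>det B\<bar>)"

text \<open>
  The distinct lattice points $y_1, \dots, y_s$ are represented by the set \<open>Y\<close> they form.
  The ambient dimension \<open>d\<close> is an explicit argument because \<open>x\<close> ranges over all of $\mathbb{R}^d$.
\<close>

definition covers :: "nat \<Rightarrow> nat \<Rightarrow> real vec set \<Rightarrow> real vec set \<Rightarrow> real \<Rightarrow> bool" where
  "covers s d K L \<mu> \<longleftrightarrow>
     (\<forall>x \<in> carrier_vec d. \<exists>Y \<subseteq> L. finite Y \<and> card Y = s \<and>
        (\<forall>y \<in> Y. x \<in> {y + \<mu> \<cdot>\<^sub>v k |k. k \<in> K}))"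

definition covering_radius :: "nat \<Rightarrow> nat \<Rightarrow> real vec set \<Rightarrow> real vec set \<Rightarrow> real" where
  "covering_radius s d K L = (LEAST \<mu>. 0 < \<mu> \<and> covers s d K L \<mu>)"

definition abs_inhom_minimum :: "nat \<Rightarrow> nat \<Rightarrow> real vec set \<Rightarrow> real" where
  "abs_inhom_minimum s d K =
     Inf {covering_radius s d K L / lattice_det d L powr (1 / real d) |L. is_lattice d L}"

definition std_simplex :: "nat \<Rightarrow> real vec set" where
  "std_simplex d = {x \<in> carrier_vec d. (\<forall>i<d. 0 \<le> x $ i) \<and> (\<Sum>i<d. x $ i) \<le> 1}"

end

theory Submission
  imports Defs
begin

text \<open>
  Write $d = n - 1$. Let $L$ be the image under $\mathrm{diag}(a_1, \dots, a_d)$ of the lattice of all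
  integer points $y$ with $a_1 y_1 + \dots + a_d y_d \equiv 0$ modulo $a_n$; its determinant is
  $a_1 \cdots a_n$. Kannan's argument identifies $\mathrm{F}_s(a) + a_1 + \dots + a_n$ with the
  $s$-covering radius of the standard simplex with respect to $L$: the points of $L$ covering $x$
  correspond to the representations of an integer $b$ in the residue class of the integer part of $x$.
  This gives (i).

  For (ii), start from a lattice with basis matrix $B$ that nearly attains the infimum. Being
  nearly optimal is an open condition on $B$, invariant under scaling, and it depends only on the
  lattice. So one may replace $B$ by $\mathrm{diag}(\alpha) H$ with $H$ an integer lower triangular
  matrix. For large $T$ the matrix $A = T H + N$, where $N$ has ones on the subdiagonal, satisfies
  $A / T \approx H$. Cramer's rule applied to $A^\intercal x = w$ with
  $w \approx A^\intercal \alpha$ yields integers $a_i$ with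
  $a_i / \det A \approx \alpha_i$, and the congruences imposed on $T$ and $w$ make
  $(a_1, \dots, a_d, \det A)$ primitive. The lattice of this vector contains
  $\mathrm{diag}(a) A \mathbb{Z}^d$, which is nearly optimal, and has the same determinant.
\<close>

subsection \<open>Integer lattices and determinants\<close>

text \<open>The determinant of the knapsack lattice is never computed exactly. Part (i) needs only
  that it is at least the product of the entries of \<open>a\<close>, which follows by counting
  residue classes. Part (ii) needs only a sublattice whose determinant equals that product, because
  extra lattice points can only improve a covering.

  The obstacle in (ii) is primitivity: the last entry is a determinant, whose prime factors are in
  general out of control. A triangular H restores control, since adding a strictly lower triangular
  N leaves det(T H + N) equal to T^d det H. Modulo the primes that remain only N survives, and it
  needs rank d - 1, as otherwise the adjugate in Cramer's rule vanishes. The subdiagonal of ones has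
  an adjugate with a single nonzero entry, 1 or -1, and the congruence on w selects it.

  The covering radius is a \<open>LEAST\<close> over the reals, so the existence of a minimum has to
  be proved; it rests on local finiteness of lattices.\<close>

lemma mult_mat_vec_nth:
  assumes "A \<in> carrier_mat d e" "z \<in> carrier_vec e" "i < d"
  shows "(A *\<^sub>v z) $ i = (\<Sum>j<e. A $$ (i,j) * z $ j)"
  using assms by (auto simp: scalar_prod_def lessThan_atLeast0 intro!: sum.cong)

text \<open>Forward substitution with remainder: a change of \<open>z\<close> at position
  \<open>k\<close> affects no coordinate before \<open>k\<close>, so the coordinates can be reduced
  one after the other. The box of remainders serves twice: to show that a triangular system
  generates, and to count residue classes.\<close>

lemma lower_triangular_reduce:
  fixes H :: "int mat"
  assumes H: "H \<in> carrier_mat d d"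
    and lower: "\<And>i j. i < j \<Longrightarrow> j < d \<Longrightarrow> H $$ (i,j) = 0"
    and pos: "\<And>i. i < d \<Longrightarrow> H $$ (i,i) > 0"
    and x: "x \<in> carrier_vec d"
  shows "\<exists>z\<in>carrier_vec d. \<forall>i<d. 0 \<le> (x - H *\<^sub>v z) $ i \<and> (x - H *\<^sub>v z) $ i < H $$ (i,i)"
proof -
  have "k \<le> d \<Longrightarrow> \<exists>z\<in>carrier_vec d. \<forall>i<k. 0 \<le> x $ i - (\<Sum>j<d. H $$ (i,j) * z $ j) \<and>
          x $ i - (\<Sum>j<d. H $$ (i,j) * z $ j) < H $$ (i,i)" for k
  proof (induction k)
    case 0
    show ?case by (auto intro: zero_carrier_vec)
  next
    case (Suc k)
    then obtain z where z: "z \<in> carrier_vec d" and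
      IH: "\<And>i. i<k \<Longrightarrow> 0 \<le> x $ i - (\<Sum>j<d. H $$ (i,j) * z $ j) \<and>
          x $ i - (\<Sum>j<d. H $$ (i,j) * z $ j) < H $$ (i,i)"
      by auto
    define c where "c = (x $ k - (\<Sum>j<d. H $$ (k,j) * z $ j)) div H $$ (k,k)"
    define z' where "z' = vec d (\<lambda>j. z $ j + (if j = k then c else 0))"
    have eq: "(\<Sum>j<d. H $$ (i,j) * z' $ j) = (\<Sum>j<d. H $$ (i,j) * z $ j) + H $$ (i,k) * c" for i
    proof -
      have "(\<Sum>j<d. H $$ (i,j) * z' $ j)
          = (\<Sum>j<d. H $$ (i,j) * z $ j + (if j = k then H $$ (i,k) * c else 0))"
        by (rule sum.cong) (auto simp: z'_def algebra_simps)
      then show ?thesis using Suc.prems by (simp add: sum.distrib)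
    qed
    have "0 \<le> x $ i - (\<Sum>j<d. H $$ (i,j) * z' $ j) \<and>
          x $ i - (\<Sum>j<d. H $$ (i,j) * z' $ j) < H $$ (i,i)" if "i < Suc k" for i
    proof (cases "i = k")
      case True
      have "x $ k - (\<Sum>j<d. H $$ (k,j) * z' $ j)
          = (x $ k - (\<Sum>j<d. H $$ (k,j) * z $ j)) mod H $$ (k,k)"
        unfolding eq c_def by (simp add: minus_mult_div_eq_mod[symmetric])
      then show ?thesis using True pos[of k] Suc.prems by simp
    next
      case False
      with that have "i < k" by simp
      then show ?thesis using IH[of i] lower[of i k] Suc.prems by (simp add: eq)
    qed
    moreover have "z' \<in> carrier_vec d" by (simp add: z'_def)
    ultimately show ?case by blast
  qed
  from this[of d] obtain z where z: "z \<in> carrier_vec d"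
    and "\<forall>i<d. 0 \<le> x $ i - (\<Sum>j<d. H $$ (i,j) * z $ j) \<and>
          x $ i - (\<Sum>j<d. H $$ (i,j) * z $ j) < H $$ (i,i)"
    by auto
  then show ?thesis
    using H x by (intro bexI[of _ z]) (auto simp: mult_mat_vec_nth[OF H z] simp del: index_mult_mat_vec)
qed

text \<open>Hermite normal form without off-diagonal reduction: column \<open>i\<close> is a vector
  of \<open>G\<close> with \<open>i\<close> leading zeros and the smallest possible positive entry
  at \<open>i\<close>. The hypothesis \<open>full\<close> is full rank in the form that this choice
  needs.\<close>

lemma triangular_basis:
  fixes G :: "int vec set"
  assumes G: "G \<subseteq> carrier_vec d" and zero: "0\<^sub>v d \<in> G"
    and diff: "\<And>x y. x \<in> G \<Longrightarrow> y \<in> G \<Longrightarrow> x - y \<in> G"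
    and full: "\<And>i. i < d \<Longrightarrow> \<exists>x\<in>G. (\<forall>k<i. x $ k = 0) \<and> x $ i > 0"
  obtains H where "H \<in> carrier_mat d d" "\<And>i j. i < j \<Longrightarrow> j < d \<Longrightarrow> H $$ (i,j) = 0"
    "\<And>i. i < d \<Longrightarrow> H $$ (i,i) > 0" "G = {H *\<^sub>v z |z. z \<in> carrier_vec d}"
proof -
  have add: "x + y \<in> G" if "x \<in> G" "y \<in> G" for x y
  proof -
    have "x - (0\<^sub>v d - y) \<in> G" using that zero diff by blast
    moreover have "x - (0\<^sub>v d - y) = x + y" using that G by (intro eq_vecI) auto
    ultimately show ?thesis by simp
  qed
  have nat_smult: "int c \<cdot>\<^sub>v x \<in> G" if "x \<in> G" for x c
  proof (induction c)
    case 0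
    have "int 0 \<cdot>\<^sub>v x = 0\<^sub>v d" using that G by (intro eq_vecI) auto
    then show ?case using zero by simp
  next
    case (Suc c)
    have "int (Suc c) \<cdot>\<^sub>v x = int c \<cdot>\<^sub>v x + x" using that G by (intro eq_vecI) (auto simp: algebra_simps)
    then show ?case using add[OF Suc that] by simp
  qed
  have smult: "c \<cdot>\<^sub>v x \<in> G" if "x \<in> G" for x c
  proof (cases "c \<ge> 0")
    case True
    then show ?thesis using nat_smult[OF that, of "nat c"] by simp
  next
    case False
    have "c \<cdot>\<^sub>v x = 0\<^sub>v d - int (nat (- c)) \<cdot>\<^sub>v x" using that G False by (intro eq_vecI) auto
    then show ?thesis using diff[OF zero nat_smult[OF that]] by metis
  qed
  define Q where "Q i x \<longleftrightarrow> x \<in> G \<and> (\<forall>k<i. x $ k = 0) \<and> x $ i > 0" for i x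
  define h where "h i = (ARG_MIN (\<lambda>x. nat (x $ i)) x. Q i x)" for i
  have h: "Q i (h i)" "\<And>x. Q i x \<Longrightarrow> h i $ i \<le> x $ i" if i: "i < d" for i
  proof -
    obtain x where "Q i x" using full[OF i] unfolding Q_def by blast
    then have *: "Q i (h i) \<and> (\<forall>y. Q i y \<longrightarrow> nat (h i $ i) \<le> nat (y $ i))"
      unfolding h_def by (rule arg_min_nat_lemma[where m = "\<lambda>x. nat (x $ i)"])
    then show "Q i (h i)" by blast
    show "h i $ i \<le> x $ i" if "Q i x" for x using * that unfolding Q_def by auto
  qed
  define H where "H = mat d d (\<lambda>(i,j). h j $ i)"
  have H: "H \<in> carrier_mat d d" by (simp add: H_def)
  have lower: "H $$ (i,j) = 0" if "i < j" "j < d" for i j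
    using h(1)[OF that(2)] that by (auto simp: H_def Q_def)
  have pos: "H $$ (i,i) > 0" if "i < d" for i
    using h(1)[OF that] that by (auto simp: H_def Q_def)
  have HG: "H *\<^sub>v z \<in> G" if z: "z \<in> carrier_vec d" for z
  proof -
    have "k \<le> d \<Longrightarrow> vec d (\<lambda>i. \<Sum>j<k. H $$ (i,j) * z $ j) \<in> G" for k
    proof (induction k)
      case 0
      have "vec d (\<lambda>i. \<Sum>j<0. H $$ (i,j) * z $ j) = 0\<^sub>v d" by (intro eq_vecI) auto
      then show ?case using zero by metis
    next
      case (Suc k)
      have hk: "h k \<in> G" using h(1)[of k] Suc.prems by (auto simp: Q_def)
      then have "h k \<in> carrier_vec d" using G by auto
      then have "vec d (\<lambda>i. \<Sum>j<Suc k. H $$ (i,j) * z $ j)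
          = vec d (\<lambda>i. \<Sum>j<k. H $$ (i,j) * z $ j) + z $ k \<cdot>\<^sub>v h k"
        using Suc.prems by (intro eq_vecI) (auto simp: H_def)
      also have "\<dots> \<in> G" using Suc by (intro add smult hk) simp
      finally show ?case .
    qed
    from this[of d] have "vec d (\<lambda>i. \<Sum>j<d. H $$ (i,j) * z $ j) \<in> G" by simp
    moreover have "H *\<^sub>v z = vec d (\<lambda>i. \<Sum>j<d. H $$ (i,j) * z $ j)"
      using H by (intro eq_vecI) (auto simp: mult_mat_vec_nth[OF H z] simp del: index_mult_mat_vec)
    ultimately show ?thesis by simp
  qed
  have "\<exists>z\<in>carrier_vec d. x = H *\<^sub>v z" if x: "x \<in> G" for x
  proof -
    have xc: "x \<in> carrier_vec d" using x G by auto
    obtain z where z: "z \<in> carrier_vec d"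
      and r: "\<And>i. i < d \<Longrightarrow> 0 \<le> (x - H *\<^sub>v z) $ i \<and> (x - H *\<^sub>v z) $ i < H $$ (i,i)"
      using lower_triangular_reduce[OF H lower pos xc] by blast
    have rG: "x - H *\<^sub>v z \<in> G" using diff[OF x HG[OF z]] .
    \<comment> \<open>The first nonzero coordinate of the remainder would be positive and smaller
      than the diagonal entry, which was chosen minimal.\<close>
    have "(x - H *\<^sub>v z) $ i = 0" if "i < d" for i
      using that
    proof (induction i rule: less_induct)
      case (less i)
      show ?case
      proof (rule ccontr)
        assume "(x - H *\<^sub>v z) $ i \<noteq> 0"
        with r[of i] less.prems have "(x - H *\<^sub>v z) $ i > 0" by linarith
        with less rG have "Q i (x - H *\<^sub>v z)" by (auto simp: Q_def)
        from h(2)[OF less.prems this] r[of i] less.prems show False by (simp add: H_def)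
      qed
    qed
    moreover have "x - H *\<^sub>v z \<in> carrier_vec d" using rG G by auto
    ultimately have "x = H *\<^sub>v z" using xc H
      by (intro eq_vecI) (auto simp del: index_mult_mat_vec)
    then show ?thesis using z by blast
  qed
  with HG have "G = {H *\<^sub>v z |z. z \<in> carrier_vec d}" by blast
  with that[OF H lower pos] show thesis by blast
qed

lemma bezout_Gcd:
  fixes f :: "nat \<Rightarrow> int"
  shows "\<exists>u. (\<Sum>i<n. f i * u i) = Gcd {f i |i. i < n}"
proof (induction n)
  case 0
  then show ?case by simp
next
  case (Suc n)
  then obtain u where u: "(\<Sum>i<n. f i * u i) = Gcd {f i |i. i < n}" by blast
  have "{f i |i. i < Suc n} = insert (f n) {f i |i. i < n}" by (auto simp: less_Suc_eq)
  then have G: "Gcd {f i |i. i < Suc n} = gcd (f n) (\<Sum>i<n. f i * u i)" using u by simp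
  obtain p q where pq: "p * f n + q * (\<Sum>i<n. f i * u i) = gcd (f n) (\<Sum>i<n. f i * u i)"
    using bezout_int by blast
  have "(\<Sum>i<Suc n. f i * (if i = n then p else q * u i)) = p * f n + q * (\<Sum>i<n. f i * u i)"
    by (simp add: sum_distrib_left mult.commute mult.left_commute)
  then have "(\<Sum>i<Suc n. f i * (if i = n then p else q * u i)) = Gcd {f i |i. i < Suc n}"
    unfolding pq G .
  then show ?case by (rule exI[of _ "\<lambda>i. if i = n then p else q * u i"])
qed

section \<open>Determinants under limits, congruences and row scaling\<close>

lemma tendsto_det:
  fixes M :: "nat \<Rightarrow> real mat"
  assumes M: "\<And>k. M k \<in> carrier_mat d d" and B: "B \<in> carrier_mat d d"
    and lim: "\<And>i j. i < d \<Longrightarrow> j < d \<Longrightarrow> (\<lambda>k. M k $$ (i,j)) \<longlonglongrightarrow> B $$ (i,j)"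
  shows "(\<lambda>k. det (M k)) \<longlonglongrightarrow> det B"
  unfolding det_def'[OF M] det_def'[OF B]
proof (intro tendsto_sum tendsto_mult tendsto_const tendsto_prod lim)
  fix p i assume "p \<in> {p. p permutes {0..<d}}" "i \<in> {0..<d}"
  then show "p i < d" using permutes_in_image[of p "{0..<d}" i] by auto
qed auto

lemma det_mod_cong:
  fixes A B :: "int mat"
  assumes A: "A \<in> carrier_mat d d" and B: "B \<in> carrier_mat d d"
    and eq: "\<And>i j. i < d \<Longrightarrow> j < d \<Longrightarrow> A $$ (i,j) mod m = B $$ (i,j) mod m"
  shows "det A mod m = det B mod m"
proof -
  have "(signof p * (\<Prod>i=0..<d. A $$ (i, p i))) mod m = (signof p * (\<Prod>i=0..<d. B $$ (i, p i))) mod m"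
    if p: "p permutes {0..<d}" for p
  proof -
    have "(\<Prod>i=0..<d. A $$ (i, p i) mod m) = (\<Prod>i=0..<d. B $$ (i, p i) mod m)"
      using permutes_in_image[OF p] by (intro prod.cong eq) auto
    then have "(\<Prod>i=0..<d. A $$ (i, p i)) mod m = (\<Prod>i=0..<d. B $$ (i, p i)) mod m"
      using mod_prod_eq[of "\<lambda>i. A $$ (i, p i)" m "{0..<d}"] mod_prod_eq[of "\<lambda>i. B $$ (i, p i)" m "{0..<d}"]
      by simp
    then show ?thesis by (rule mod_mult_cong[OF refl])
  qed
  then have "(\<Sum>p | p permutes {0..<d}. (signof p * (\<Prod>i=0..<d. A $$ (i, p i))) mod m) mod m
     = (\<Sum>p | p permutes {0..<d}. (signof p * (\<Prod>i=0..<d. B $$ (i, p i))) mod m) mod m"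
    by (subst sum.cong[OF refl]) auto
  then show ?thesis unfolding det_def'[OF A] det_def'[OF B] by (simp add: mod_sum_eq)
qed

text \<open>Left multiplication by diag(\<open>f\<close>). A constant \<open>f\<close> is a
  homothety of the lattice; the entries of a knapsack vector turn the lattice of a congruence into
  the knapsack lattice.\<close>

definition scale_rows :: "nat \<Rightarrow> (nat \<Rightarrow> 'a) \<Rightarrow> 'a::comm_ring_1 mat \<Rightarrow> 'a mat" where
  "scale_rows d f A = mat d d (\<lambda>(i,j). f i * A $$ (i,j))"

lemma scale_rows_carrier [simp]: "scale_rows d f A \<in> carrier_mat d d"
  by (simp add: scale_rows_def)

lemma det_scale_rows:
  assumes A: "A \<in> carrier_mat d d"
  shows "det (scale_rows d f A) = (\<Prod>i<d. f i) * det A"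
proof -
  have "det (scale_rows d f A)
      = (\<Sum>p | p permutes {0..<d}. signof p * (\<Prod>i=0..<d. f i * A $$ (i, p i)))"
    unfolding det_def'[OF scale_rows_carrier]
  proof (intro sum.cong refl arg_cong2[of _ _ _ _ "(*)"] prod.cong)
    fix p i assume "p \<in> {p. p permutes {0..<d}}" "i \<in> {0..<d}"
    then show "scale_rows d f A $$ (i, p i) = f i * A $$ (i, p i)"
      using permutes_in_image[of p "{0..<d}" i] by (auto simp: scale_rows_def)
  qed
  also have "\<dots> = (\<Prod>i<d. f i) * det A"
    unfolding det_def'[OF A] prod.distrib sum_distrib_left
    by (intro sum.cong refl) (simp add: lessThan_atLeast0 mult.left_commute)
  finally show ?thesis .
qed

subsection \<open>Lattices and simplex coverings\<close>

lemma mat_inverse_exists: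
  fixes B :: "real mat"
  assumes B: "B \<in> carrier_mat d d" and det: "det B \<noteq> 0"
  obtains C where "C \<in> carrier_mat d d" "B * C = 1\<^sub>m d" "C * B = 1\<^sub>m d"
proof -
  note adj = adj_mat[OF B]
  let ?C = "(1 / det B) \<cdot>\<^sub>m adj_mat B"
  have "B * ?C = 1\<^sub>m d"
    using adj B det by (subst mult_smult_distrib[OF B adj(1)]) (auto intro!: eq_matI)
  moreover have "?C * B = 1\<^sub>m d"
    using adj B det by (subst mult_smult_assoc_mat[OF adj(1) B]) (auto intro!: eq_matI)
  ultimately show thesis using that adj(1) by (meson smult_carrier_mat)
qed

lemma inverse_mult_mat_vec:
  fixes B :: "real mat"
  assumes "B \<in> carrier_mat d d" "C \<in> carrier_mat d d" "B * C = 1\<^sub>m d" "x \<in> carrier_vec d"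
  shows "B *\<^sub>v (C *\<^sub>v x) = x"
  using assms by (metis assoc_mult_mat_vec one_mult_mat_vec)

definition lattice_of :: "nat \<Rightarrow> real mat \<Rightarrow> real vec set" where
  "lattice_of d B = {B *\<^sub>v z |z. z \<in> integer_vecs d}"

lemma integer_vecs_carrier: "z \<in> integer_vecs d \<Longrightarrow> z \<in> carrier_vec d"
  by (simp add: integer_vecs_def)

lemma lattice_of_carrier: "B \<in> carrier_mat d d \<Longrightarrow> lattice_of d B \<subseteq> carrier_vec d"
  by (auto simp: lattice_of_def integer_vecs_def)

lemma lattice_of_map_int:
  assumes H: "H \<in> carrier_mat d d"
  shows "lattice_of d (map_mat real_of_int H) = {map_vec real_of_int (H *\<^sub>v z) |z. z \<in> carrier_vec d}"
proof -
  have "integer_vecs d = map_vec real_of_int ` carrier_vec d"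
  proof (intro equalityI subsetI)
    fix x assume x: "x \<in> integer_vecs d"
    have "x = map_vec real_of_int (vec d (\<lambda>i. \<lfloor>x $ i\<rfloor>))"
      using x by (intro eq_vecI) (auto simp: integer_vecs_def)
    then show "x \<in> map_vec real_of_int ` carrier_vec d" by (metis image_eqI vec_carrier)
  qed (auto simp: integer_vecs_def)
  then have "lattice_of d (map_mat real_of_int H)
      = {map_mat real_of_int H *\<^sub>v map_vec real_of_int z |z. z \<in> carrier_vec d}"
    by (auto simp: lattice_of_def)
  also have "\<dots> = {map_vec real_of_int (H *\<^sub>v z) |z. z \<in> carrier_vec d}"
    using of_int_hom.mult_mat_vec_hom[OF H] by (metis (no_types, opaque_lifting))
  finally show ?thesis .
qed

lemma lattice_of_scale_rows:
  assumes B: "B \<in> carrier_mat d d"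
  shows "lattice_of d (scale_rows d f B) = (\<lambda>y. vec d (\<lambda>i. f i * y $ i)) ` lattice_of d B"
proof -
  have "scale_rows d f B *\<^sub>v z = vec d (\<lambda>i. f i * (B *\<^sub>v z) $ i)" if "z \<in> integer_vecs d" for z
  proof (rule eq_vecI)
    fix i assume "i < dim_vec (vec d (\<lambda>i. f i * (B *\<^sub>v z) $ i))"
    then have i: "i < d" by simp
    show "(scale_rows d f B *\<^sub>v z) $ i = vec d (\<lambda>i. f i * (B *\<^sub>v z) $ i) $ i"
      unfolding mult_mat_vec_nth[OF scale_rows_carrier integer_vecs_carrier[OF that] i]
      using i by (simp add: mult_mat_vec_nth[OF B integer_vecs_carrier[OF that] i] scale_rows_def
          sum_distrib_left mult.assoc del: index_mult_mat_vec)
  qed (simp add: scale_rows_def)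
  then show ?thesis unfolding lattice_of_def by (auto simp: image_iff) metis
qed

text \<open>The generators of the smaller lattice are integer combinations of those of the larger
  one, so \<open>C = B * U\<close> with \<open>U\<close> integral, and the nonzero integer
  \<open>det U\<close> has absolute value at least 1. Applied in both directions this makes
  \<open>lattice_det\<close> independent of the basis.\<close>

lemma abs_det_le_of_sublattice:
  assumes B: "B \<in> carrier_mat d d" and C: "C \<in> carrier_mat d d" and det: "det C \<noteq> 0"
    and sub: "lattice_of d C \<subseteq> lattice_of d B"
  shows "\<bar>det B\<bar> \<le> \<bar>det C\<bar>"
proof -
  have "\<exists>u\<in>integer_vecs d. C *\<^sub>v unit_vec d j = B *\<^sub>v u" if "j < d" for j
  proof -
    have "unit_vec d j \<in> integer_vecs d" by (auto simp: integer_vecs_def unit_vec_def)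
    then show ?thesis using sub unfolding lattice_of_def by blast
  qed
  then obtain u where u: "\<And>j. j < d \<Longrightarrow> u j \<in> integer_vecs d"
      "\<And>j. j < d \<Longrightarrow> C *\<^sub>v unit_vec d j = B *\<^sub>v u j" by metis
  define U where "U = mat d d (\<lambda>(i,j). u j $ i)"
  have U: "U \<in> carrier_mat d d" by (simp add: U_def)
  have col: "col U j = u j" if "j < d" for j
    using u(1)[OF that] that by (intro eq_vecI) (auto simp: U_def integer_vecs_def)
  have "C = B * U"
  proof (rule eq_matI)
    fix i j assume "i < dim_row (B * U)" "j < dim_col (B * U)"
    then have ij: "i < d" "j < d" using B U by auto
    have "C $$ (i,j) = (C *\<^sub>v unit_vec d j) $ i" using ij C by simp
    also have "\<dots> = (B * U) $$ (i,j)" using ij B U by (simp add: u(2) col)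
    finally show "C $$ (i,j) = (B * U) $$ (i,j)" .
  qed (use B C U in auto)
  then have eq: "det C = det B * det U" using det_mult[OF B U] by simp
  have "det U \<in> \<int>" unfolding det_def'[OF U]
  proof (intro Ints_sum Ints_mult Ints_prod)
    fix p i assume "p \<in> {p. p permutes {0..<d}}" "i \<in> {0..<d}"
    then have "i < d" "p i < d" using permutes_in_image[of p "{0..<d}" i] by auto
    then show "U $$ (i, p i) \<in> \<int>" using u(1)[of "p i"] by (auto simp: U_def integer_vecs_def)
  qed auto
  then obtain k where k: "det U = of_int k" by (auto elim: Ints_cases)
  with eq det have "k \<noteq> 0" by auto
  then have "1 \<le> \<bar>k\<bar>" by linarith
  then have "1 \<le> \<bar>det U\<bar>" unfolding k by linarith
  then show ?thesis unfolding eq abs_mult by (simp add: mult_le_cancel_left1)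
qed

lemma lattice_det_eq:
  assumes "is_lattice_basis d B L"
  shows "lattice_det d L = \<bar>det B\<bar>"
  unfolding lattice_det_def
proof (rule the_equality)
  fix D assume "\<exists>B. is_lattice_basis d B L \<and> D = \<bar>det B\<bar>"
  then obtain C where "is_lattice_basis d C L" and D: "D = \<bar>det C\<bar>" by blast
  with assms show "D = \<bar>det B\<bar>"
    unfolding is_lattice_basis_def D
    by (intro antisym abs_det_le_of_sublattice[of _ d]) (auto simp: lattice_of_def)
qed (use assms in blast)

section \<open>Lattice points whose simplex contains a given point\<close>

lemma finite_bounded_integer_vecs: "finite {z \<in> integer_vecs d. \<forall>i<d. \<bar>z $ i\<bar> \<le> N}"
proof -
  let ?F = "(\<lambda>f. vec d (\<lambda>i. real_of_int (f i))) ` ({..<d} \<rightarrow>\<^sub>E {-\<lfloor>N\<rfloor>..\<lfloor>N\<rfloor>})"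
  have "z \<in> ?F" if z: "z \<in> integer_vecs d" "\<forall>i<d. \<bar>z $ i\<bar> \<le> N" for z
  proof (rule image_eqI)
    show "z = vec d (\<lambda>i. real_of_int ((\<lambda>i\<in>{..<d}. \<lfloor>z $ i\<rfloor>) i))"
      using z by (intro eq_vecI) (auto simp: integer_vecs_def)
    show "(\<lambda>i\<in>{..<d}. \<lfloor>z $ i\<rfloor>) \<in> {..<d} \<rightarrow>\<^sub>E {-\<lfloor>N\<rfloor>..\<lfloor>N\<rfloor>}"
    proof (rule restrict_PiE_iff[THEN iffD2], intro ballI)
      fix i assume "i \<in> {..<d}"
      then have "z $ i \<in> \<int>" "\<bar>z $ i\<bar> \<le> N" using z by (auto simp: integer_vecs_def)
      moreover from this obtain k where k: "z $ i = of_int k" by (auto elim: Ints_cases)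
      ultimately have "\<bar>k\<bar> \<le> \<lfloor>N\<rfloor>" by (simp add: le_floor_iff)
      then show "\<lfloor>z $ i\<rfloor> \<in> {-\<lfloor>N\<rfloor>..\<lfloor>N\<rfloor>}" using k by auto
    qed
  qed
  then have "{z \<in> integer_vecs d. \<forall>i<d. \<bar>z $ i\<bar> \<le> N} \<subseteq> ?F" by blast
  moreover have "finite ?F" by (intro finite_imageI finite_PiE) auto
  ultimately show ?thesis by (rule finite_subset)
qed

text \<open>These are the lattice points whose translate of the simplex scaled by \<mu> contains
  \<open>x\<close>. The inequalities involve no division by \<mu> and keep their meaning at factor
  0.\<close>

definition covering_points :: "nat \<Rightarrow> real vec set \<Rightarrow> real \<Rightarrow> real vec \<Rightarrow> real vec set" where
  "covering_points d L \<mu> x = {y \<in> L. (\<forall>i<d. y $ i \<le> x $ i) \<and> (\<Sum>i<d. x $ i - y $ i) \<le> \<mu>}"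

lemma mem_translated_simplex_iff:
  assumes x: "x \<in> carrier_vec d" and y: "y \<in> carrier_vec d" and \<mu>: "0 \<le> \<mu>"
  shows "x \<in> {y + \<mu> \<cdot>\<^sub>v k |k. k \<in> std_simplex d} \<longleftrightarrow>
    (\<forall>i<d. y $ i \<le> x $ i) \<and> (\<Sum>i<d. x $ i - y $ i) \<le> \<mu>" (is "?l \<longleftrightarrow> ?r")
proof
  assume ?l
  then obtain k where k: "k \<in> std_simplex d" and xk: "x = y + \<mu> \<cdot>\<^sub>v k" by blast
  have kc: "k \<in> carrier_vec d" and k0: "\<And>i. i < d \<Longrightarrow> 0 \<le> k $ i" and k1: "(\<Sum>i<d. k $ i) \<le> 1"
    using k by (auto simp: std_simplex_def)
  have *: "x $ i - y $ i = \<mu> * k $ i" if "i < d" for i using that y kc by (simp add: xk)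
  have "(\<Sum>i<d. x $ i - y $ i) = \<mu> * (\<Sum>i<d. k $ i)"
    unfolding sum_distrib_left by (intro sum.cong) (auto simp: *)
  moreover have "\<mu> * (\<Sum>i<d. k $ i) \<le> \<mu>" using mult_left_mono[OF k1 \<mu>] by simp
  moreover have "y $ i \<le> x $ i" if "i < d" for i
    using *[OF that] mult_nonneg_nonneg[OF \<mu> k0[OF that]] by linarith
  ultimately show ?r by simp
next
  assume r: ?r
  show ?l
  \<comment> \<open>The factor 0 is included because the infimum of the covering factors is at first
    only known to be nonnegative. There the translate is the single point \<open>y\<close>, and the
    inequalities force \<open>x = y\<close>.\<close>
  proof (cases "\<mu> = 0")
    case True
    have nonneg: "0 \<le> x $ i - y $ i" if "i < d" for i using r that by simp
    have "(\<Sum>i<d. x $ i - y $ i) = 0" using r True nonneg by (intro antisym sum_nonneg) auto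
    then have "\<forall>i\<in>{..<d}. x $ i - y $ i = 0" using nonneg by (subst (asm) sum_nonneg_eq_0_iff) auto
    then have "x = y + \<mu> \<cdot>\<^sub>v 0\<^sub>v d" using x y True by (intro eq_vecI) auto
    moreover have "0\<^sub>v d \<in> std_simplex d" by (auto simp: std_simplex_def)
    ultimately show ?thesis by blast
  next
    case False
    with \<mu> have pos: "0 < \<mu>" by simp
    define k where "k = (1 / \<mu>) \<cdot>\<^sub>v (x - y)"
    have "x = y + \<mu> \<cdot>\<^sub>v k" using pos x y by (intro eq_vecI) (auto simp: k_def)
    moreover have "k \<in> std_simplex d"
    proof -
      have "(\<Sum>i<d. k $ i) = (\<Sum>i<d. x $ i - y $ i) / \<mu>"
        unfolding sum_divide_distrib using x y by (intro sum.cong) (auto simp: k_def)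
      then show ?thesis using r pos x y by (auto simp: std_simplex_def k_def)
    qed
    ultimately show ?thesis by blast
  qed
qed

lemma covers_simplex_iff:
  assumes L: "L \<subseteq> carrier_vec d" and \<mu>: "0 \<le> \<mu>"
  shows "covers s d (std_simplex d) L \<mu> \<longleftrightarrow>
    (\<forall>x\<in>carrier_vec d. \<exists>Y\<subseteq>covering_points d L \<mu> x. finite Y \<and> card Y = s)"
proof -
  have "(Y \<subseteq> L \<and> finite Y \<and> card Y = s \<and> (\<forall>y\<in>Y. x \<in> {y + \<mu> \<cdot>\<^sub>v k |k. k \<in> std_simplex d})) \<longleftrightarrow>
      (Y \<subseteq> covering_points d L \<mu> x \<and> finite Y \<and> card Y = s)" if "x \<in> carrier_vec d" for x Y
    using mem_translated_simplex_iff[OF that _ \<mu>] L unfolding covering_points_def by blast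
  then show ?thesis unfolding covers_def by simp
qed

lemma covers_mono:
  assumes "covers s d (std_simplex d) L \<mu>" "L \<subseteq> L'" "L' \<subseteq> carrier_vec d" "0 \<le> \<mu>" "\<mu> \<le> \<mu>'"
  shows "covers s d (std_simplex d) L' \<mu>'"
proof -
  have "covering_points d L \<mu> x \<subseteq> covering_points d L' \<mu>' x" for x
    using assms by (auto simp: covering_points_def)
  moreover have "L \<subseteq> carrier_vec d" "0 \<le> \<mu>'" using assms by auto
  ultimately show ?thesis
    using assms(1) covers_simplex_iff[of L d \<mu> s] covers_simplex_iff[of L' d \<mu>' s] assms
    by (meson subset_trans)
qed

text \<open>The conditions \<open>y \<le> x\<close> and total gap at most \<mu> bound every
  coordinate of \<open>y\<close>; the inverse matrix carries this bound over to the integer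
  coordinates.\<close>

lemma finite_covering_points:
  assumes B: "B \<in> carrier_mat d d" and det: "det B \<noteq> 0"
  shows "finite (covering_points d (lattice_of d B) \<mu> x)"
proof -
  obtain C where C: "C \<in> carrier_mat d d" and CB: "C * B = 1\<^sub>m d"
    using mat_inverse_exists[OF B det] by blast
  define R where "R = (\<Sum>i<d. \<bar>x $ i\<bar>) + \<bar>\<mu>\<bar>"
  define N where "N = (\<Sum>i<d. \<Sum>j<d. \<bar>C $$ (i,j)\<bar> * R)"
  have R0: "0 \<le> R" unfolding R_def by (intro add_nonneg_nonneg sum_nonneg) auto
  have "y \<in> (\<lambda>z. B *\<^sub>v z) ` {z \<in> integer_vecs d. \<forall>i<d. \<bar>z $ i\<bar> \<le> N}"
    if y: "y \<in> covering_points d (lattice_of d B) \<mu> x" for y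
  proof -
    obtain z where z: "z \<in> integer_vecs d" and yz: "y = B *\<^sub>v z"
      using y by (auto simp: covering_points_def lattice_of_def)
    have yc: "y \<in> carrier_vec d" using yz B integer_vecs_carrier[OF z] by simp
    have zy: "z = C *\<^sub>v y" unfolding yz
      using inverse_mult_mat_vec[OF C B CB integer_vecs_carrier[OF z]] by simp
    have le: "y $ i \<le> x $ i" if "i < d" for i using y that by (simp add: covering_points_def)
    have sum: "(\<Sum>i<d. x $ i - y $ i) \<le> \<mu>" using y by (simp add: covering_points_def)
    have yR: "\<bar>y $ i\<bar> \<le> R" if i: "i < d" for i
    proof -
      have "x $ i - y $ i \<le> (\<Sum>i<d. x $ i - y $ i)"
        using le i by (intro member_le_sum) auto
      moreover have "\<bar>x $ i\<bar> \<le> (\<Sum>i<d. \<bar>x $ i\<bar>)" using i by (intro member_le_sum) auto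
      ultimately show ?thesis using sum le[OF i] unfolding R_def by linarith
    qed
    have "\<bar>z $ i\<bar> \<le> N" if i: "i < d" for i
    proof -
      have "\<bar>z $ i\<bar> \<le> (\<Sum>j<d. \<bar>C $$ (i,j) * y $ j\<bar>)"
        unfolding zy mult_mat_vec_nth[OF C yc i] by (rule sum_abs)
      also have "\<dots> \<le> (\<Sum>j<d. \<bar>C $$ (i,j)\<bar> * R)"
        by (intro sum_mono) (auto simp: abs_mult intro!: mult_left_mono yR)
      also have "\<dots> \<le> N" unfolding N_def using i R0
        by (intro member_le_sum[of i _ "\<lambda>i. \<Sum>j<d. \<bar>C $$ (i,j)\<bar> * R"] sum_nonneg) auto
      finally show ?thesis .
    qed
    with z yz show ?thesis by blast
  qed
  then show ?thesis using finite_bounded_integer_vecs[of d N]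
    by (meson finite_imageI finite_subset subsetI)
qed

text \<open>Move \<open>x\<close> down by \<open>E\<close> in every coordinate, round its
  coordinates with respect to \<open>B\<close> down, and take \<open>s\<close> steps along the first
  basis vector to get distinct points. Rounding and steps change the basis coordinates by at most
  \<open>s + 1\<close>, hence each coordinate by at most \<open>E\<close>, so all gaps to
  \<open>x\<close> lie between 0 and \<open>2 * E\<close>.\<close>

lemma covers_exists:
  assumes B: "B \<in> carrier_mat d d" and det: "det B \<noteq> 0" and d: "0 < d"
  shows "\<exists>\<mu>>0. covers s d (std_simplex d) (lattice_of d B) \<mu>"
proof -
  obtain C where C: "C \<in> carrier_mat d d" and BC: "B * C = 1\<^sub>m d" and CB: "C * B = 1\<^sub>m d"
    using mat_inverse_exists[OF B det] by blast
  define R where "R = (\<Sum>i<d. \<Sum>j<d. \<bar>B $$ (i,j)\<bar>)"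
  have R0: "0 \<le> R" unfolding R_def by (intro sum_nonneg) auto
  have row: "(\<Sum>j<d. \<bar>B $$ (i,j)\<bar>) \<le> R" if "i < d" for i
    unfolding R_def using that by (intro member_le_sum[of i _ "\<lambda>i. \<Sum>j<d. \<bar>B $$ (i,j)\<bar>"] sum_nonneg) auto
  have bound: "\<bar>(B *\<^sub>v v) $ i\<bar> \<le> (real s + 1) * R"
    if v: "v \<in> carrier_vec d" and le: "\<And>j. j < d \<Longrightarrow> \<bar>v $ j\<bar> \<le> real s + 1" and i: "i < d" for v i
  proof -
    have "\<bar>(B *\<^sub>v v) $ i\<bar> \<le> (\<Sum>j<d. \<bar>B $$ (i,j) * v $ j\<bar>)"
      unfolding mult_mat_vec_nth[OF B v i] by (rule sum_abs)
    also have "\<dots> \<le> (\<Sum>j<d. \<bar>B $$ (i,j)\<bar> * (real s + 1))"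
      by (intro sum_mono) (auto simp: abs_mult intro!: mult_left_mono le)
    also have "\<dots> = (real s + 1) * (\<Sum>j<d. \<bar>B $$ (i,j)\<bar>)" by (simp add: sum_distrib_right[symmetric])
    also have "\<dots> \<le> (real s + 1) * R" using row[OF i] by (intro mult_left_mono) auto
    finally show ?thesis .
  qed
  define E where "E = (real s + 1) * R"
  have E0: "0 \<le> E" unfolding E_def using R0 by simp
  \<comment> \<open>The summand 1 yields a positive factor from \<open>0 \<le> E\<close>
    alone.\<close>
  define \<mu> where "\<mu> = real d * (2 * E) + 1"
  have \<mu>0: "0 < \<mu>" unfolding \<mu>_def using E0 by (simp add: add_nonneg_pos)
  have "\<exists>Y\<subseteq>covering_points d (lattice_of d B) \<mu> x. finite Y \<and> card Y = s" if x: "x \<in> carrier_vec d" for x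
  proof -
    define x1 where "x1 = vec d (\<lambda>i. x $ i - E)"
    have x1: "x1 \<in> carrier_vec d" by (simp add: x1_def)
    define r where "r = C *\<^sub>v x1"
    have r: "r \<in> carrier_vec d" using C x1 by (simp add: r_def)
    have Br: "B *\<^sub>v r = x1" unfolding r_def using inverse_mult_mat_vec[OF B C BC x1] .
    define z where "z k = vec d (\<lambda>j. of_int \<lfloor>r $ j\<rfloor> - (if j = 0 then real k else 0))" for k :: nat
    have z: "z k \<in> integer_vecs d" for k by (auto simp: z_def integer_vecs_def)
    have inj: "inj_on (\<lambda>k. B *\<^sub>v z k) {..<s}"
    proof (rule inj_onI)
      fix k l assume "B *\<^sub>v z k = B *\<^sub>v z l"
      then have "z k = z l"
        using inverse_mult_mat_vec[OF C B CB integer_vecs_carrier[OF z]] by metis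
      then have "z k $ 0 = z l $ 0" by simp
      then show "k = l" using d by (simp add: z_def)
    qed
    have pt: "B *\<^sub>v z k \<in> covering_points d (lattice_of d B) \<mu> x" if k: "k < s" for k
    proof -
      have diff: "\<bar>x1 $ i - (B *\<^sub>v z k) $ i\<bar> \<le> E" if i: "i < d" for i
      proof -
        have "\<bar>(r - z k) $ j\<bar> \<le> real s + 1" if j: "j < d" for j
        proof -
          have "0 \<le> r $ j - of_int \<lfloor>r $ j\<rfloor>" "r $ j - of_int \<lfloor>r $ j\<rfloor> < 1" by linarith+
          moreover have "(r - z k) $ j = r $ j - of_int \<lfloor>r $ j\<rfloor> + (if j = 0 then real k else 0)"
            using j r by (simp add: z_def)
          moreover have "0 \<le> (if j = 0 then real k else 0)" "(if j = 0 then real k else 0) \<le> real s"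
            using k by auto
          ultimately show ?thesis by linarith
        qed
        then have "\<bar>(B *\<^sub>v (r - z k)) $ i\<bar> \<le> E" unfolding E_def
          using r integer_vecs_carrier[OF z] by (intro bound i) auto
        moreover have "B *\<^sub>v (r - z k) = x1 - B *\<^sub>v z k"
          using mult_minus_distrib_mat_vec[OF B r integer_vecs_carrier[OF z]] Br by simp
        ultimately show ?thesis using i B by (simp del: index_mult_mat_vec)
      qed
      have x1i: "x1 $ i = x $ i - E" if "i < d" for i using that by (simp add: x1_def)
      have "(B *\<^sub>v z k) $ i \<le> x $ i \<and> x $ i - (B *\<^sub>v z k) $ i \<le> 2 * E" if i: "i < d" for i
        using diff[OF i] x1i[OF i] by linarith
      moreover from this have "(\<Sum>i<d. x $ i - (B *\<^sub>v z k) $ i) \<le> (\<Sum>i<d. 2 * E)"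
        by (intro sum_mono) auto
      ultimately show ?thesis using z unfolding covering_points_def lattice_of_def \<mu>_def by auto
    qed
    show ?thesis
      using pt card_image[OF inj] by (intro exI[of _ "(\<lambda>k. B *\<^sub>v z k) ` {..<s}"]) auto
  qed
  then show ?thesis using \<mu>0 covers_simplex_iff[OF lattice_of_carrier[OF B], of \<mu> s] by auto
qed

text \<open>At factor 0 only lattice points are covered, and the image under \<open>B\<close> of the
  vector with all entries 1/2 is not one. This excludes 0 as the infimum of the covering
  factors.\<close>

lemma not_covers_0:
  assumes B: "B \<in> carrier_mat d d" and det: "det B \<noteq> 0" and d: "0 < d" and s: "0 < s"
  shows "\<not> covers s d (std_simplex d) (lattice_of d B) 0"
proof
  assume cov: "covers s d (std_simplex d) (lattice_of d B) 0"
  obtain C where C: "C \<in> carrier_mat d d" and CB: "C * B = 1\<^sub>m d"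
    using mat_inverse_exists[OF B det] by blast
  define h :: "real vec" where "h = vec d (\<lambda>_. 1/2)"
  have h: "h \<in> carrier_vec d" by (simp add: h_def)
  have Bh: "B *\<^sub>v h \<in> carrier_vec d" using B h by simp
  then obtain Y where Y: "Y \<subseteq> lattice_of d B" "card Y = s"
      "\<forall>y\<in>Y. B *\<^sub>v h \<in> {y + 0 \<cdot>\<^sub>v k |k. k \<in> std_simplex d}"
    using cov unfolding covers_def by blast
  then obtain y where "y \<in> Y" using s by fastforce
  with Y obtain k where y: "y \<in> lattice_of d B" "B *\<^sub>v h = y + 0 \<cdot>\<^sub>v k" "k \<in> std_simplex d"
    by blast
  then obtain z where z: "z \<in> integer_vecs d" "y = B *\<^sub>v z" by (auto simp: lattice_of_def)
  have "y \<in> carrier_vec d" using y(1) lattice_of_carrier[OF B] by auto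
  then have "y + 0 \<cdot>\<^sub>v k = y" using y(3) by (intro eq_vecI) (auto simp: std_simplex_def)
  then have "B *\<^sub>v h = B *\<^sub>v z" using y(2) z(2) by metis
  then have "h = z"
    using inverse_mult_mat_vec[OF C B CB] h integer_vecs_carrier[OF z(1)] by metis
  then have "1/2 \<in> (\<int> :: real set)" using z(1) d by (auto simp: integer_vecs_def h_def)
  then obtain k :: int where "1/2 = real_of_int k" by (auto elim: Ints_cases)
  then have "1 = 2 * k" by linarith
  then show False by presburger
qed

text \<open>The infimum \<open>m\<close> is attained because, for a fixed \<open>x\<close>, only
  finitely many lattice points become usable between \<open>m\<close> and \<open>m + 1\<close>. A
  covering factor slightly above \<open>m\<close> therefore uses no points at \<open>x\<close>
  beyond those available at \<open>m\<close>.\<close>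

lemma covering_radius_is_least:
  assumes B: "B \<in> carrier_mat d d" and det: "det B \<noteq> 0" and d: "0 < d" and s: "0 < s"
  defines "\<rho> \<equiv> covering_radius s d (std_simplex d) (lattice_of d B)"
  shows "0 < \<rho>" "covers s d (std_simplex d) (lattice_of d B) \<rho>"
    "\<And>\<mu>. 0 < \<mu> \<Longrightarrow> covers s d (std_simplex d) (lattice_of d B) \<mu> \<Longrightarrow> \<rho> \<le> \<mu>"
proof -
  let ?L = "lattice_of d B"
  let ?A = "{\<mu>. 0 < \<mu> \<and> covers s d (std_simplex d) ?L \<mu>}"
  note Lc = lattice_of_carrier[OF B]
  define m where "m = Inf ?A"
  have ne: "?A \<noteq> {}" using covers_exists[OF B det d, of s] by blast
  have bdd: "bdd_below ?A" by (rule bdd_belowI[of _ 0]) auto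
  have m0: "0 \<le> m" unfolding m_def by (rule cInf_greatest[OF ne]) auto
  have lower: "m \<le> \<mu>" if "\<mu> \<in> ?A" for \<mu> unfolding m_def by (rule cInf_lower[OF that bdd])
  have "\<exists>Y\<subseteq>covering_points d ?L m x. finite Y \<and> card Y = s" if x: "x \<in> carrier_vec d" for x
  proof -
    define P where "P = covering_points d ?L (m + 1) x"
    \<comment> \<open>\<open>V\<close> collects the distances that exceed \<open>m\<close>. Adding
      \<open>m + 1\<close> makes it nonempty and keeps the factor chosen below \<open>Min V\<close>
      under \<open>m + 1\<close>, so that all its points lie in \<open>P\<close>.\<close>
    define V where "V = insert (m + 1) ((\<lambda>y. \<Sum>i<d. x $ i - y $ i) ` (P - covering_points d ?L m x))"
    have finV: "finite V" unfolding V_def P_def using finite_covering_points[OF B det] by simp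
    have "\<And>v. v \<in> V \<Longrightarrow> m < v" unfolding V_def P_def by (auto simp: covering_points_def)
    then have "m < Min V" using finV by (subst Min_gr_iff) (auto simp: V_def)
    then obtain \<mu> where \<mu>: "\<mu> \<in> ?A" "\<mu> < Min V" using cInf_lessD[OF ne] unfolding m_def by blast
    have less: "\<mu> < v" if "v \<in> V" for v using \<mu>(2) Min_le[OF finV that] by linarith
    have "covering_points d ?L \<mu> x \<subseteq> covering_points d ?L m x"
    proof
      fix y assume y: "y \<in> covering_points d ?L \<mu> x"
      have "\<mu> < m + 1" by (rule less) (simp add: V_def)
      with y have "y \<in> P" by (auto simp: P_def covering_points_def)
      show "y \<in> covering_points d ?L m x"
      proof (rule ccontr)
        assume "y \<notin> covering_points d ?L m x"
        with \<open>y \<in> P\<close> have "\<mu> < (\<Sum>i<d. x $ i - y $ i)" by (intro less) (simp add: V_def)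
        with y show False by (simp add: covering_points_def)
      qed
    qed
    moreover have "\<exists>Y\<subseteq>covering_points d ?L \<mu> x. finite Y \<and> card Y = s"
      using \<mu>(1) covers_simplex_iff[OF Lc, of \<mu> s] x by auto
    ultimately show ?thesis by blast
  qed
  then have cov: "covers s d (std_simplex d) ?L m" using covers_simplex_iff[OF Lc m0] by blast
  then have "m \<noteq> 0" using not_covers_0[OF B det d s] by metis
  then have mpos: "0 < m" using m0 by simp
  have "\<rho> = m" unfolding \<rho>_def covering_radius_def
    using mpos cov lower by (intro Least_equality) auto
  then show "0 < \<rho>" "covers s d (std_simplex d) ?L \<rho>"
    "\<And>\<mu>. 0 < \<mu> \<Longrightarrow> covers s d (std_simplex d) ?L \<mu> \<Longrightarrow> \<rho> \<le> \<mu>"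
    using mpos cov lower by auto
qed

subsection \<open>Stability of nearly optimal bases\<close>

text \<open>The map \<open>\<psi> = B' * C\<close> carries one lattice onto the other and differs
  from the identity by the small matrix \<open>D\<close>. A covering of the preimage of
  \<open>x\<close> is transported by \<psi>; the gaps change by \<open>D *\<^sub>v u\<close>, each
  entry of which is at most \<open>\<eta> * \<mu>\<close> in absolute value.\<close>

lemma covers_perturb:
  assumes B: "B \<in> carrier_mat d d" and C: "C \<in> carrier_mat d d" and BC: "B * C = 1\<^sub>m d"
    and CB: "C * B = 1\<^sub>m d" and B': "B' \<in> carrier_mat d d" and det': "det B' \<noteq> 0"
    and \<eta>: "\<And>i j. i < d \<Longrightarrow> j < d \<Longrightarrow> \<bar>((B' - B) * C) $$ (i,j)\<bar> \<le> \<eta>" "0 \<le> \<eta>" and \<mu>: "0 \<le> \<mu>"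
    and cov: "covers s d (std_simplex d) (lattice_of d B) \<mu>"
  shows "covers s d (std_simplex d) (lattice_of d B') (\<mu> + 2 * real d * (\<eta> * \<mu>))"
proof -
  obtain C' where C': "C' \<in> carrier_mat d d" and BC': "B' * C' = 1\<^sub>m d" and CB': "C' * B' = 1\<^sub>m d"
    using mat_inverse_exists[OF B' det'] by blast
  define D where "D = (B' - B) * C"
  have D: "D \<in> carrier_mat d d" using C minus_carrier_mat[OF B] unfolding D_def by (rule mult_carrier_mat[rotated])
  define \<psi> where "\<psi> v = B' *\<^sub>v (C *\<^sub>v v)" for v
  have \<psi>_carrier: "\<psi> v \<in> carrier_vec d" if "v \<in> carrier_vec d" for v
    using that B' C by (simp add: \<psi>_def)
  have \<psi>_eq: "\<psi> v = v + D *\<^sub>v v" if v: "v \<in> carrier_vec d" for v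
  proof -
    have Cv: "C *\<^sub>v v \<in> carrier_vec d" using C v by simp
    have "D *\<^sub>v v = (B' - B) *\<^sub>v (C *\<^sub>v v)" unfolding D_def
      using minus_carrier_mat[OF B] C v by (rule assoc_mult_mat_vec)
    also have "\<dots> = \<psi> v - v"
      unfolding \<psi>_def minus_mult_distrib_mat_vec[OF B' B Cv]
      using inverse_mult_mat_vec[OF B C BC v] by simp
    finally show ?thesis using v \<psi>_carrier[OF v] D by (intro eq_vecI) auto
  qed
  define c where "c = \<eta> * \<mu>"
  have "\<exists>Y\<subseteq>covering_points d (lattice_of d B') (\<mu> + 2 * real d * c) x. finite Y \<and> card Y = s"
    if x: "x \<in> carrier_vec d" for x
  proof -
    \<comment> \<open>The shift by \<open>c\<close> compensates for the worst value
      \<open>- c\<close> of the distortion, so gaps stay nonnegative. Shift and distortion together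
      cost at most \<open>2 * c\<close> per coordinate, whence the term
      \<open>2 * real d * (\<eta> * \<mu>)\<close>.\<close>
    define x1 where "x1 = vec d (\<lambda>i. x $ i - c)"
    have x1: "x1 \<in> carrier_vec d" by (simp add: x1_def)
    define x' where "x' = B *\<^sub>v (C' *\<^sub>v x1)"
    have x': "x' \<in> carrier_vec d" using B C' x1 by (simp add: x'_def)
    have \<psi>x': "\<psi> x' = x1"
      unfolding \<psi>_def x'_def
      using inverse_mult_mat_vec[OF C B CB, of "C' *\<^sub>v x1"] inverse_mult_mat_vec[OF B' C' BC' x1] C' x1
      by simp
    obtain Y where Y: "Y \<subseteq> covering_points d (lattice_of d B) \<mu> x'" "finite Y" "card Y = s"
      using cov x' covers_simplex_iff[OF lattice_of_carrier[OF B] \<mu>] by blast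
    have Yc: "y \<in> carrier_vec d" if "y \<in> Y" for y
      using Y(1) that lattice_of_carrier[OF B] by (auto simp: covering_points_def)
    have inj: "inj_on \<psi> Y"
    proof (rule inj_onI)
      fix y1 y2 assume y: "y1 \<in> Y" "y2 \<in> Y" "\<psi> y1 = \<psi> y2"
      have "C *\<^sub>v y1 = C *\<^sub>v y2"
        using y(3) inverse_mult_mat_vec[OF C' B' CB'] Yc[OF y(1)] Yc[OF y(2)] C
        unfolding \<psi>_def by (metis mult_mat_vec_carrier)
      then show "y1 = y2"
        using inverse_mult_mat_vec[OF B C BC] Yc[OF y(1)] Yc[OF y(2)] by metis
    qed
    have pt: "\<psi> y \<in> covering_points d (lattice_of d B') (\<mu> + 2 * real d * c) x" if y: "y \<in> Y" for y
    proof -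
      have yc: "y \<in> carrier_vec d" using Yc[OF y] .
      have yL: "y \<in> lattice_of d B" using Y(1) y by (auto simp: covering_points_def)
      then obtain z where z: "z \<in> integer_vecs d" "y = B *\<^sub>v z" by (auto simp: lattice_of_def)
      have "\<psi> y = B' *\<^sub>v z" unfolding \<psi>_def z(2)
        using inverse_mult_mat_vec[OF C B CB integer_vecs_carrier[OF z(1)]] by simp
      then have mem: "\<psi> y \<in> lattice_of d B'" using z by (auto simp: lattice_of_def)
      define u where "u = x' - y"
      have u: "u \<in> carrier_vec d" using x' yc by (simp add: u_def)
      have ui: "u $ i = x' $ i - y $ i" if "i < d" for i using that x' yc by (simp add: u_def)
      have u0: "0 \<le> u $ i" if "i < d" for i
        using Y(1) y that ui[OF that] by (auto simp: covering_points_def)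
      have us: "(\<Sum>i<d. u $ i) \<le> \<mu>"
        using Y(1) y ui by (auto simp: covering_points_def)
      \<comment> \<open>The entries of \<open>D\<close> are at most \<eta> and the nonnegative
        entries of \<open>u\<close> sum to at most \<mu>, so no factor \<open>d\<close> is lost
        here.\<close>
      have Du: "\<bar>(D *\<^sub>v u) $ i\<bar> \<le> c" if i: "i < d" for i
      proof -
        have "\<bar>(D *\<^sub>v u) $ i\<bar> \<le> (\<Sum>j<d. \<bar>D $$ (i,j) * u $ j\<bar>)"
          unfolding mult_mat_vec_nth[OF D u i] by (rule sum_abs)
        also have "\<dots> \<le> (\<Sum>j<d. \<eta> * u $ j)"
          using \<eta>(1)[OF i] u0 by (intro sum_mono) (auto simp: abs_mult D_def[symmetric] intro!: mult_right_mono)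
        also have "\<dots> \<le> c" unfolding c_def sum_distrib_left[symmetric]
          using us \<eta>(2) by (rule mult_left_mono)
        finally show ?thesis .
      qed
      have "\<psi> u = x1 - \<psi> y"
      proof -
        have "C *\<^sub>v u = C *\<^sub>v x' - C *\<^sub>v y" unfolding u_def
          by (rule mult_minus_distrib_mat_vec[OF C x' yc])
        then have "\<psi> u = \<psi> x' - \<psi> y" unfolding \<psi>_def
          using mult_minus_distrib_mat_vec[OF B', of "C *\<^sub>v x'" "C *\<^sub>v y"] C x' yc by simp
        then show ?thesis by (simp add: \<psi>x')
      qed
      then have eq: "(x1 - \<psi> y) $ i = (u + D *\<^sub>v u) $ i" for i using \<psi>_eq[OF u] by simp
      have diff: "x $ i - \<psi> y $ i = c + u $ i + (D *\<^sub>v u) $ i" if "i < d" for i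
        using that eq[of i] \<psi>_carrier[OF yc] u D x1 by (simp add: x1_def del: index_mult_mat_vec)
      have "\<psi> y $ i \<le> x $ i" if "i < d" for i
        using diff[OF that] Du[OF that] u0[OF that] by linarith
      moreover have "(\<Sum>i<d. x $ i - \<psi> y $ i) \<le> \<mu> + 2 * real d * c"
      proof -
        have "(\<Sum>i<d. x $ i - \<psi> y $ i) \<le> (\<Sum>i<d. u $ i + 2 * c)"
        proof (rule sum_mono)
          fix i assume "i \<in> {..<d}"
          then show "x $ i - \<psi> y $ i \<le> u $ i + 2 * c" using diff[of i] Du[of i] by simp
        qed
        then show ?thesis using us by (simp add: sum.distrib)
      qed
      ultimately show ?thesis using mem by (simp add: covering_points_def)
    qed
    show ?thesis using pt Y(2,3) card_image[OF inj] by (intro exI[of _ "\<psi> ` Y"]) auto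
  qed
  moreover have "0 \<le> \<mu> + 2 * real d * c" using \<mu> \<eta>(2) by (simp add: c_def)
  ultimately show ?thesis
    using covers_simplex_iff[OF lattice_of_carrier[OF B']] unfolding c_def by blast
qed

text \<open>With \<open>c\<close> slightly above the absolute minimum this is near-optimality. A
  witness \<mu> stands in place of the covering radius, so that coverings can be transported
  directly; the strict inequality makes the condition open.\<close>

definition efficient_basis :: "nat \<Rightarrow> nat \<Rightarrow> real \<Rightarrow> real mat \<Rightarrow> bool" where
  "efficient_basis s d c B \<longleftrightarrow> B \<in> carrier_mat d d \<and> det B \<noteq> 0 \<and>
     (\<exists>\<mu>>0. covers s d (std_simplex d) (lattice_of d B) \<mu> \<and> \<mu> < c * \<bar>det B\<bar> powr (1 / real d))"

text \<open>The strict inequality leaves room for an intermediate \<mu>'. Continuity of the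
  determinant keeps the right side above \<mu>', and the perturbation bound keeps the covering
  factor at most \<mu>'.\<close>

lemma efficient_basis_eventually:
  assumes B: "efficient_basis s d c B" and M: "\<And>k. M k \<in> carrier_mat d d"
    and lim: "\<And>i j. i < d \<Longrightarrow> j < d \<Longrightarrow> (\<lambda>k. M k $$ (i,j)) \<longlonglongrightarrow> B $$ (i,j)"
  shows "\<forall>\<^sub>F k in sequentially. efficient_basis s d c (M k)"
proof -
  have Bc: "B \<in> carrier_mat d d" and det: "det B \<noteq> 0" using B by (auto simp: efficient_basis_def)
  obtain \<mu> where \<mu>: "0 < \<mu>" "covers s d (std_simplex d) (lattice_of d B) \<mu>"
      "\<mu> < c * \<bar>det B\<bar> powr (1 / real d)"
    using B by (auto simp: efficient_basis_def)
  obtain \<mu>' where \<mu>': "\<mu> < \<mu>'" "\<mu>' < c * \<bar>det B\<bar> powr (1 / real d)" using dense[OF \<mu>(3)] by blast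
  obtain C where C: "C \<in> carrier_mat d d" "B * C = 1\<^sub>m d" "C * B = 1\<^sub>m d"
    using mat_inverse_exists[OF Bc det] by blast
  \<comment> \<open>Chosen so that the perturbation loss
    \<open>2 * real d * (\<eta> * \<mu>)\<close> fits into \<open>\<mu>' - \<mu>\<close>; the
    summand 1 keeps the denominator positive also for \<open>d = 0\<close>.\<close>
  define \<eta> where "\<eta> = (\<mu>' - \<mu>) / (2 * real d * \<mu> + 1)"
  have den: "0 < 2 * real d * \<mu> + 1" using \<mu>(1) by (simp add: add_nonneg_pos)
  have \<eta>: "0 < \<eta>" unfolding \<eta>_def using den \<mu>'(1) by simp
  have "\<eta> * (2 * real d * \<mu> + 1) = \<mu>' - \<mu>" using den by (simp add: \<eta>_def)
  then have le: "\<mu> + 2 * real d * (\<eta> * \<mu>) \<le> \<mu>'" using \<eta> by (simp add: algebra_simps)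
  note limdet = tendsto_det[OF M Bc lim]
  have "(\<lambda>k. c * \<bar>det (M k)\<bar> powr (1 / real d)) \<longlonglongrightarrow> c * \<bar>det B\<bar> powr (1 / real d)"
    using det by (intro tendsto_intros limdet) auto
  then have ev1: "\<forall>\<^sub>F k in sequentially. \<mu>' < c * \<bar>det (M k)\<bar> powr (1 / real d)"
    using \<mu>'(2) by (rule order_tendstoD)
  have ev2: "\<forall>\<^sub>F k in sequentially. det (M k) \<noteq> 0"
    using limdet det by (rule tendsto_imp_eventually_ne)
  have entry: "((M k - B) * C) $$ (i,j) = (\<Sum>l<d. (M k $$ (i,l) - B $$ (i,l)) * C $$ (l,j))"
    if "i < d" "j < d" for k i j
    using that M[of k] Bc C by (auto simp: scalar_prod_def lessThan_atLeast0 intro!: sum.cong)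
  have "\<forall>\<^sub>F k in sequentially. \<bar>((M k - B) * C) $$ (i,j)\<bar> < \<eta>" if ij: "i < d" "j < d" for i j
  proof -
    have "(\<lambda>k. \<bar>\<Sum>l<d. (M k $$ (i,l) - B $$ (i,l)) * C $$ (l,j)\<bar>)
        \<longlonglongrightarrow> \<bar>\<Sum>l<d. (B $$ (i,l) - B $$ (i,l)) * C $$ (l,j)\<bar>"
      using ij by (intro tendsto_intros lim) auto
    then show ?thesis unfolding entry[OF ij] using \<eta> by (intro order_tendstoD) auto
  qed
  then have "\<forall>\<^sub>F k in sequentially. \<forall>i\<in>{..<d}. \<forall>j\<in>{..<d}. \<bar>((M k - B) * C) $$ (i,j)\<bar> < \<eta>"
    by (intro eventually_ball_finite ballI) auto
  with ev1 ev2 show ?thesis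
  proof eventually_elim
    case (elim k)
    have "covers s d (std_simplex d) (lattice_of d (M k)) (\<mu> + 2 * real d * (\<eta> * \<mu>))"
      using elim(3) by (intro covers_perturb[OF Bc C M elim(2) _ _ _ \<mu>(2)]) (use \<eta> \<mu>(1) in \<open>auto intro: less_imp_le\<close>)
    from this subset_refl lattice_of_carrier[OF M] _ le
    have "covers s d (std_simplex d) (lattice_of d (M k)) \<mu>'"
      by (rule covers_mono) (use \<eta> \<mu>(1) in simp)
    then show ?case unfolding efficient_basis_def using elim M \<mu>(1) \<mu>'(1)
      by (intro conjI exI[of _ \<mu>']) auto
  qed
qed

lemma covers_scale:
  assumes B: "B \<in> carrier_mat d d" and r: "0 < r" and \<mu>: "0 \<le> \<mu>"
    and cov: "covers s d (std_simplex d) (lattice_of d B) \<mu>"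
  shows "covers s d (std_simplex d) (lattice_of d (scale_rows d (\<lambda>_. r) B)) (r * \<mu>)"
proof -
  let ?f = "\<lambda>y. vec d (\<lambda>i. r * y $ i) :: real vec"
  have "\<exists>Y\<subseteq>covering_points d (lattice_of d (scale_rows d (\<lambda>_. r) B)) (r * \<mu>) x. finite Y \<and> card Y = s"
    if x: "x \<in> carrier_vec d" for x
  proof -
    define x' where "x' = vec d (\<lambda>i. x $ i / r)"
    have x': "x' \<in> carrier_vec d" by (simp add: x'_def)
    obtain Y where Y: "Y \<subseteq> covering_points d (lattice_of d B) \<mu> x'" "finite Y" "card Y = s"
      using cov x' covers_simplex_iff[OF lattice_of_carrier[OF B] \<mu>] by blast
    have inj: "inj_on ?f Y"
    proof (rule inj_onI)
      fix y1 y2 assume y: "y1 \<in> Y" "y2 \<in> Y" "?f y1 = ?f y2"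
      have c: "y1 \<in> carrier_vec d" "y2 \<in> carrier_vec d"
        using y Y(1) lattice_of_carrier[OF B] by (auto simp: covering_points_def)
      have "r * y1 $ i = r * y2 $ i" if "i < d" for i
        using arg_cong[OF y(3), of "\<lambda>v. v $ i"] that by simp
      then show "y1 = y2" using c r by (intro eq_vecI) auto
    qed
    have pt: "?f y \<in> covering_points d (lattice_of d (scale_rows d (\<lambda>_. r) B)) (r * \<mu>) x"
      if y: "y \<in> Y" for y
    proof -
      have yp: "y \<in> lattice_of d B" "\<And>i. i < d \<Longrightarrow> y $ i \<le> x $ i / r" "(\<Sum>i<d. x' $ i - y $ i) \<le> \<mu>"
        using Y(1) y by (auto simp: covering_points_def x'_def)
      have "(\<Sum>i<d. x $ i - ?f y $ i) = r * (\<Sum>i<d. x' $ i - y $ i)"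
        unfolding sum_distrib_left using r by (intro sum.cong) (auto simp: x'_def algebra_simps)
      then have "(\<Sum>i<d. x $ i - ?f y $ i) \<le> r * \<mu>" using yp(3) r by simp
      moreover have "?f y $ i \<le> x $ i" if "i < d" for i
        using yp(2)[OF that] r that by (simp add: field_simps)
      ultimately show ?thesis
        using yp(1) by (auto simp: covering_points_def lattice_of_scale_rows[OF B])
    qed
    show ?thesis using pt Y(2,3) card_image[OF inj] by (intro exI[of _ "?f ` Y"]) auto
  qed
  then show ?thesis
    using covers_simplex_iff[OF lattice_of_carrier[OF scale_rows_carrier], of "r * \<mu>"] r \<mu> by auto
qed

text \<open>The determinant scales by \<open>r ^ d\<close>, its \<open>d\<close>-th root by
  \<open>r\<close>, just as the covering factor does.\<close>

lemma efficient_basis_scale: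
  assumes B: "efficient_basis s d c B" and r: "0 < r" and d: "0 < d"
  shows "efficient_basis s d c (scale_rows d (\<lambda>_. r) B)"
proof -
  have Bc: "B \<in> carrier_mat d d" and det: "det B \<noteq> 0" using B by (auto simp: efficient_basis_def)
  obtain \<mu> where \<mu>: "0 < \<mu>" "covers s d (std_simplex d) (lattice_of d B) \<mu>"
      "\<mu> < c * \<bar>det B\<bar> powr (1 / real d)"
    using B by (auto simp: efficient_basis_def)
  have deteq: "det (scale_rows d (\<lambda>_. r) B) = r ^ d * det B" by (simp add: det_scale_rows[OF Bc])
  have "\<bar>r ^ d * det B\<bar> powr (1 / real d) = (r ^ d) powr (1 / real d) * \<bar>det B\<bar> powr (1 / real d)"
    using r by (simp add: abs_mult powr_mult)
  also have "(r ^ d) powr (1 / real d) = r" using r d by (simp add: powr_realpow[symmetric] powr_powr)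
  finally have "r * \<mu> < c * \<bar>det (scale_rows d (\<lambda>_. r) B)\<bar> powr (1 / real d)"
    unfolding deteq using mult_strict_left_mono[OF \<mu>(3) r] by (simp add: mult_ac)
  moreover have "covers s d (std_simplex d) (lattice_of d (scale_rows d (\<lambda>_. r) B)) (r * \<mu>)"
    using \<mu> r by (intro covers_scale[OF Bc]) auto
  ultimately show ?thesis unfolding efficient_basis_def using deteq det r \<mu>(1)
    by (auto intro!: exI[of _ "r * \<mu>"])
qed

lemma efficient_basis_cong:
  assumes "efficient_basis s d c B" "B' \<in> carrier_mat d d" "det B' \<noteq> 0" "lattice_of d B = lattice_of d B'"
  shows "efficient_basis s d c B'"
proof -
  have "\<bar>det B\<bar> = \<bar>det B'\<bar>"
    using assms abs_det_le_of_sublattice[of B d B'] abs_det_le_of_sublattice[of B' d B]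
    by (auto simp: efficient_basis_def intro!: antisym)
  then show ?thesis using assms unfolding efficient_basis_def by auto
qed

subsection \<open>The knapsack lattice and the Frobenius number\<close>

lemma det_lower_triangular_prod:
  fixes A :: "'a::comm_ring_1 mat"
  assumes "A \<in> carrier_mat d d" "\<And>i j. i < j \<Longrightarrow> j < d \<Longrightarrow> A $$ (i,j) = 0"
  shows "det A = (\<Prod>i<d. A $$ (i,i))"
  using assms by (subst det_lower_triangular[OF assms(2) assms(1)])
    (auto simp: diag_mat_def prod.distinct_set_conv_list[symmetric] lessThan_atLeast0)

abbreviation representations :: "int vec \<Rightarrow> int \<Rightarrow> real vec set" where
  "representations a b \<equiv> knapsack_polytope a b \<inter> integer_vecs (dim_vec a)"

text \<open>The factor \<open>a $ i\<close> in coordinate \<open>i\<close> turns the weight of a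
  partial representation into a plain coordinate sum, so that the standard simplex measures
  it.\<close>

definition knapsack_lattice :: "nat \<Rightarrow> int vec \<Rightarrow> real vec set" where
  "knapsack_lattice d a =
     {vec d (\<lambda>i. real_of_int (a $ i * y $ i)) |y :: int vec.
        y \<in> carrier_vec d \<and> a $ d dvd (\<Sum>i<d. a $ i * y $ i)}"

lemma knapsack_lattice_carrier: "knapsack_lattice d a \<subseteq> carrier_vec d"
  by (auto simp: knapsack_lattice_def)

lemma representations_iff:
  assumes a: "primitive_pos_vec n a"
  shows "x \<in> representations a b \<longleftrightarrow>
    x \<in> integer_vecs n \<and> (\<forall>i<n. 0 \<le> x $ i) \<and> (\<Sum>i<n. real_of_int (a $ i) * x $ i) = real_of_int b"
proof -
  have dim: "dim_vec a = n" using a by (auto simp: primitive_pos_vec_def)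
  have "map_vec real_of_int a \<bullet> x = (\<Sum>i<n. real_of_int (a $ i) * x $ i)" if "x \<in> carrier_vec n"
    using that dim by (auto simp: scalar_prod_def lessThan_atLeast0 intro!: sum.cong)
  then show ?thesis by (auto simp: knapsack_polytope_def integer_vecs_def dim)
qed

text \<open>Since \<open>card\<close> of an infinite set is 0, an injection into the representations
  bounds their number from below only once they are known to be finite.\<close>

lemma finite_representations:
  assumes a: "primitive_pos_vec n a"
  shows "finite (representations a b)"
proof (rule finite_subset)
  show "representations a b \<subseteq> {z \<in> integer_vecs n. \<forall>i<n. \<bar>z $ i\<bar> \<le> \<bar>real_of_int b\<bar>}"
  proof
    fix z assume z: "z \<in> representations a b"
    note z' = representations_iff[OF a, THEN iffD1, OF z]
    have "\<bar>z $ i\<bar> \<le> \<bar>real_of_int b\<bar>" if i: "i < n" for i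
    proof -
      have a1: "1 \<le> real_of_int (a $ j)" if "j < n" for j
        using a that by (auto simp: primitive_pos_vec_def int_one_le_iff_zero_less)
      have "z $ i \<le> real_of_int (a $ i) * z $ i"
        using mult_right_mono[OF a1[OF i], of "z $ i"] z' i by simp
      also have "\<dots> \<le> (\<Sum>i<n. real_of_int (a $ i) * z $ i)"
      proof (rule member_le_sum)
        fix j assume "j \<in> {..<n} - {i}"
        then show "0 \<le> real_of_int (a $ j) * z $ j" using a1[of j] z' by (intro mult_nonneg_nonneg) auto
      qed (use i in auto)
      finally show ?thesis using z' i by auto
    qed
    with z' show "z \<in> {z \<in> integer_vecs n. \<forall>i<n. \<bar>z $ i\<bar> \<le> \<bar>real_of_int b\<bar>}" by blast
  qed
qed (rule finite_bounded_integer_vecs)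

text \<open>A Bezout combination multiplied by \<open>b\<close>; its last term vanishes modulo
  \<open>a $ d\<close>. The gcd condition on a given \<open>a\<close> enters the argument
  here.\<close>

lemma primitive_residue_solvable:
  assumes a: "primitive_pos_vec (Suc d) a"
  obtains x :: "int vec" where "x \<in> carrier_vec d" "a $ d dvd b - (\<Sum>i<d. a $ i * x $ i)"
proof -
  obtain u where u: "(\<Sum>i<Suc d. a $ i * u i) = 1"
    using bezout_Gcd[of "\<lambda>i. a $ i" "Suc d"] a by (auto simp: primitive_pos_vec_def)
  define x where "x = vec d (\<lambda>i. b * u i)"
  have "(\<Sum>i<d. a $ i * x $ i) = b * (\<Sum>i<d. a $ i * u i)"
    unfolding sum_distrib_left by (intro sum.cong) (auto simp: x_def)
  also have "(\<Sum>i<d. a $ i * u i) = 1 - a $ d * u d" using u by simp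
  finally have "b - (\<Sum>i<d. a $ i * x $ i) = a $ d * (b * u d)" by (simp add: algebra_simps)
  then show thesis using that[of x] by (simp add: x_def)
qed

text \<open>One half of Kannan's correspondence. Let \<open>x0\<close> solve the congruence for
  \<open>b\<close>. A lattice point with multipliers \<open>v\<close> that covers a point just below
  \<open>x0 + 1\<close> has \<open>v \<le> x0\<close> by integrality. Then \<open>x0 - v\<close>
  gives the first \<open>d\<close> coordinates of a representation, and the last coordinate absorbs
  the rest of \<open>b\<close>.\<close>

lemma covers_knapsack_imp_representations:
  assumes a: "primitive_pos_vec (Suc d) a" and \<mu>: "0 \<le> \<mu>"
    and cov: "covers s d (std_simplex d) (knapsack_lattice d a) \<mu>"
    and less: "\<mu> < real_of_int b + (\<Sum>i<Suc d. real_of_int (a $ i))"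
  shows "s \<le> card (representations a b)"
proof -
  have pos: "0 < a $ i" if "i < Suc d" for i using a that by (auto simp: primitive_pos_vec_def)
  obtain x0 :: "int vec" where x0: "x0 \<in> carrier_vec d" "a $ d dvd b - (\<Sum>i<d. a $ i * x0 $ i)"
    using primitive_residue_solvable[OF a] by blast
  define S where "S = (\<Sum>i<d. real_of_int (a $ i))"
  have S0: "0 \<le> S" unfolding S_def using pos by (intro sum_nonneg) (auto simp: less_imp_le)
  define g where "g = real_of_int b + S + real_of_int (a $ d) - \<mu>"
  have g: "0 < g" using less by (simp add: g_def S_def)
  \<comment> \<open>\<open>g\<close> is the slack in the assumption on \<open>b\<close>. Moving off
    the integer point loses \<open>\<eta> * S\<close>, which has to stay below \<open>g\<close>;
    \<open>S + 1\<close> avoids a zero denominator.\<close>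
  define \<eta> where "\<eta> = min 1 (g / (S + 1))"
  have \<eta>: "0 < \<eta>" "\<eta> \<le> 1" using g S0 by (auto simp: \<eta>_def)
  have \<eta>S: "\<eta> * S < g"
  proof -
    have "\<eta> * S \<le> g / (S + 1) * S" using S0 by (intro mult_right_mono) (auto simp: \<eta>_def)
    also have "\<dots> < g" using g S0 by (simp add: field_simps)
    finally show ?thesis .
  qed
  \<comment> \<open>A point just below the next integer point: covering it costs almost the full sum of the first \<open>d\<close> entries.\<close>
  define x where "x = vec d (\<lambda>i. real_of_int (a $ i) * (real_of_int (x0 $ i) + 1 - \<eta>))"
  have "x \<in> carrier_vec d" by (simp add: x_def)
  then obtain Y where Y: "Y \<subseteq> covering_points d (knapsack_lattice d a) \<mu> x" "finite Y" "card Y = s"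
    using cov covers_simplex_iff[OF knapsack_lattice_carrier[of d a] \<mu>, of s] by meson
  define \<phi> :: "real vec \<Rightarrow> real vec" where
    "\<phi> y = vec (Suc d) (\<lambda>i. if i < d then real_of_int (x0 $ i) - y $ i / real_of_int (a $ i)
      else (real_of_int b - (\<Sum>i<d. real_of_int (a $ i) * real_of_int (x0 $ i) - y $ i)) / real_of_int (a $ d))" for y
  have inj: "inj_on \<phi> Y"
  proof (rule inj_onI)
    fix y1 y2 assume y: "y1 \<in> Y" "y2 \<in> Y" "\<phi> y1 = \<phi> y2"
    have c: "y1 \<in> carrier_vec d" "y2 \<in> carrier_vec d"
      using y Y(1) knapsack_lattice_carrier[of d a] by (auto simp: covering_points_def)
    have "y1 $ i = y2 $ i" if "i < d" for i
      using arg_cong[OF y(3), of "\<lambda>v. v $ i"] that pos[of i] by (simp add: \<phi>_def)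
    then show "y1 = y2" using c by (intro eq_vecI) auto
  qed
  have "\<phi> y \<in> representations a b" if y: "y \<in> Y" for y
  proof -
    have yp: "y \<in> knapsack_lattice d a" "\<And>i. i < d \<Longrightarrow> y $ i \<le> x $ i" "(\<Sum>i<d. x $ i - y $ i) \<le> \<mu>"
      using Y(1) y by (auto simp: covering_points_def)
    then obtain v :: "int vec" where v: "v \<in> carrier_vec d" "a $ d dvd (\<Sum>i<d. a $ i * v $ i)"
      "y = vec d (\<lambda>i. real_of_int (a $ i * v $ i))" by (auto simp: knapsack_lattice_def)
    have vle: "v $ i \<le> x0 $ i" if i: "i < d" for i
    proof -
      have "real_of_int (a $ i) * real_of_int (v $ i) \<le> real_of_int (a $ i) * (real_of_int (x0 $ i) + 1 - \<eta>)"
        using yp(2)[OF i] i by (simp add: v(3) x_def)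
      then have "real_of_int (v $ i) \<le> real_of_int (x0 $ i) + 1 - \<eta>" using pos[of i] i by simp
      then show ?thesis using \<eta>(1) by linarith
    qed
    define q where "q = (\<Sum>i<d. a $ i * (x0 $ i - v $ i))"
    have q_real: "(\<Sum>i<d. real_of_int (a $ i) * real_of_int (x0 $ i) - y $ i) = real_of_int q"
      unfolding q_def of_int_sum by (intro sum.cong) (auto simp: v(3) algebra_simps)
    have "(\<Sum>i<d. x $ i - y $ i) = (\<Sum>i<d. real_of_int (a $ i) * real_of_int (x0 $ i) - y $ i + (1 - \<eta>) * real_of_int (a $ i))"
      by (intro sum.cong) (auto simp: x_def algebra_simps)
    also have "\<dots> = real_of_int q + (1 - \<eta>) * S"
      unfolding sum.distrib q_real S_def sum_distrib_left ..
    finally have "real_of_int q + (1 - \<eta>) * S \<le> \<mu>" using yp(3) by simp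
    then have "real_of_int q < real_of_int b + real_of_int (a $ d)"
      using \<eta>S by (simp add: g_def algebra_simps)
    then have qb: "q < b + a $ d" by linarith
    have "q = (\<Sum>i<d. a $ i * x0 $ i) - (\<Sum>i<d. a $ i * v $ i)"
      unfolding q_def sum_subtractf[symmetric] by (intro sum.cong) (auto simp: algebra_simps)
    then have "b - q = (b - (\<Sum>i<d. a $ i * x0 $ i)) + (\<Sum>i<d. a $ i * v $ i)" by simp
    then have "a $ d dvd b - q" using dvd_add[OF x0(2) v(2)] by metis
    then obtain k where k: "b - q = a $ d * k" by (auto elim: dvdE)
    \<comment> \<open>\<open>b - q\<close> is a multiple of \<open>a $ d\<close> that exceeds
      \<open>- a $ d\<close>, hence it is nonnegative.\<close>
    have "0 < a $ d * (k + 1)" using qb k by (simp add: algebra_simps)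
    then have k0: "0 \<le> k" using pos[of d] by (simp add: zero_less_mult_iff)
    have \<phi>i: "\<phi> y $ i = real_of_int (x0 $ i - v $ i)" if "i < d" for i
      using that pos[of i] by (simp add: \<phi>_def v(3))
    have "real_of_int b - real_of_int q = real_of_int (a $ d) * real_of_int k"
      using k by (metis of_int_diff of_int_mult)
    then have \<phi>d: "\<phi> y $ d = real_of_int k" using pos[of d] by (simp add: \<phi>_def q_real)
    have "(\<Sum>i<Suc d. real_of_int (a $ i) * \<phi> y $ i)
        = real_of_int q + real_of_int (a $ d) * real_of_int k"
      by (simp add: \<phi>d \<phi>i q_def)
    also have "\<dots> = real_of_int (q + a $ d * k)" by simp
    also have "q + a $ d * k = b" using k by simp
    finally have sum: "(\<Sum>i<Suc d. real_of_int (a $ i) * \<phi> y $ i) = real_of_int b" .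
    have "\<phi> y $ i \<in> \<int> \<and> 0 \<le> \<phi> y $ i" if "i < Suc d" for i
      using that \<phi>d k0 vle[of i] by (cases "i = d") (auto simp: \<phi>i less_Suc_eq)
    moreover have "\<phi> y \<in> carrier_vec (Suc d)" by (simp add: \<phi>_def)
    ultimately show ?thesis using representations_iff[OF a, of "\<phi> y" b] sum
      unfolding integer_vecs_def by blast
  qed
  then have "card Y \<le> card (representations a b)"
    by (intro card_inj_on_le[OF inj _ finite_representations[OF a]]) auto
  then show ?thesis using Y(3) by simp
qed

text \<open>The other half. Rounding \<open>x\<close> down to multiples of the \<open>a $ i\<close>
  loses a total \<open>t\<close>, at most the sum of the first \<open>d\<close> entries. The largest
  \<open>b\<close> in the residue class of the rounded point with \<open>b \<le> \<mu> - t\<close>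
  then exceeds \<open>F\<close>. Subtracting a representation of \<open>b\<close> from the rounded
  point gives a lattice point at total distance at most \<open>t + b\<close>.\<close>

lemma representations_imp_covers_knapsack:
  assumes a: "primitive_pos_vec (Suc d) a"
    and rep: "\<And>b. F < b \<Longrightarrow> s \<le> card (representations a b)"
    and nonneg: "0 \<le> real_of_int F + (\<Sum>i<Suc d. real_of_int (a $ i))"
  shows "covers s d (std_simplex d) (knapsack_lattice d a) (real_of_int F + (\<Sum>i<Suc d. real_of_int (a $ i)))"
proof -
  have pos: "0 < a $ i" if "i < Suc d" for i using a that by (auto simp: primitive_pos_vec_def)
  define \<mu> where "\<mu> = real_of_int F + (\<Sum>i<Suc d. real_of_int (a $ i))"
  have "\<exists>Y\<subseteq>covering_points d (knapsack_lattice d a) \<mu> x. finite Y \<and> card Y = s"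
    if x: "x \<in> carrier_vec d" for x
  proof -
    define x0 where "x0 i = \<lfloor>x $ i / real_of_int (a $ i)\<rfloor>" for i
    define t where "t = (\<Sum>i<d. x $ i - real_of_int (a $ i) * real_of_int (x0 i))"
    have frac: "0 \<le> x $ i - real_of_int (a $ i) * real_of_int (x0 i)"
      "x $ i - real_of_int (a $ i) * real_of_int (x0 i) \<le> real_of_int (a $ i)" if i: "i < d" for i
    proof -
      have ai: "0 < real_of_int (a $ i)" using pos[of i] i by simp
      have "real_of_int (x0 i) \<le> x $ i / real_of_int (a $ i)"
        "x $ i / real_of_int (a $ i) \<le> real_of_int (x0 i) + 1" unfolding x0_def by linarith+
      then show "0 \<le> x $ i - real_of_int (a $ i) * real_of_int (x0 i)"
        "x $ i - real_of_int (a $ i) * real_of_int (x0 i) \<le> real_of_int (a $ i)"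
        using ai by (auto simp: field_simps)
    qed
    have tS: "t \<le> (\<Sum>i<d. real_of_int (a $ i))" unfolding t_def by (intro sum_mono frac) auto
    define r where "r = (\<Sum>i<d. a $ i * x0 i)"
    \<comment> \<open>Steps of length \<open>a $ d\<close> stay in the residue class, so
      \<open>b\<close> lands in an interval of that length ending at \<open>\<mu> - t\<close>. This
      interval accounts for the last entry in the sum defining \<mu>.\<close>
    define k where "k = \<lfloor>(\<mu> - t - real_of_int r) / real_of_int (a $ d)\<rfloor>"
    define b where "b = r + a $ d * k"
    have ad: "0 < real_of_int (a $ d)" using pos[of d] by simp
    have "real_of_int k \<le> (\<mu> - t - real_of_int r) / real_of_int (a $ d)"
      "(\<mu> - t - real_of_int r) / real_of_int (a $ d) < real_of_int k + 1" unfolding k_def by linarith+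
    then have "real_of_int k * real_of_int (a $ d) \<le> \<mu> - t - real_of_int r"
      "\<mu> - t - real_of_int r < (real_of_int k + 1) * real_of_int (a $ d)"
      using ad by (auto simp: pos_le_divide_eq pos_divide_less_eq)
    then have b: "real_of_int b \<le> \<mu> - t" "\<mu> - t < real_of_int b + real_of_int (a $ d)"
      by (auto simp: b_def algebra_simps)
    have "real_of_int F < real_of_int b" using b(2) tS by (simp add: \<mu>_def)
    then have "s \<le> card (representations a b)" by (intro rep) simp
    then obtain Z where Z: "Z \<subseteq> representations a b" "card Z = s" "finite Z"
      by (meson obtain_subset_with_card_n)
    define \<psi> where "\<psi> u = vec d (\<lambda>i. real_of_int (a $ i) * (real_of_int (x0 i) - u $ i))" for u :: "real vec"
    have Zp: "u \<in> integer_vecs (Suc d)" "\<forall>i<Suc d. 0 \<le> u $ i"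
      "(\<Sum>i<d. real_of_int (a $ i) * u $ i) = real_of_int b - real_of_int (a $ d) * u $ d" if "u \<in> Z" for u
      using Z(1) that representations_iff[OF a, of u b] by auto
    have inj: "inj_on \<psi> Z"
    proof (rule inj_onI)
      fix u v assume uv: "u \<in> Z" "v \<in> Z" "\<psi> u = \<psi> v"
      have eq: "u $ i = v $ i" if "i < d" for i
        using arg_cong[OF uv(3), of "\<lambda>v. v $ i"] that pos[of i] by (simp add: \<psi>_def)
      \<comment> \<open>\<open>\<psi>\<close> forgets the last coordinate; the weight equation
        recovers it.\<close>
      have "real_of_int b - real_of_int (a $ d) * u $ d = real_of_int b - real_of_int (a $ d) * v $ d"
        unfolding Zp(3)[OF uv(1), symmetric] Zp(3)[OF uv(2), symmetric] by (simp add: eq)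
      then have "u $ d = v $ d" using ad by simp
      then show "u = v" using eq Zp(1)[OF uv(1)] Zp(1)[OF uv(2)]
        by (intro eq_vecI) (auto simp: integer_vecs_def less_Suc_eq)
    qed
    have pt: "\<psi> u \<in> covering_points d (knapsack_lattice d a) \<mu> x" if u: "u \<in> Z" for u
    proof -
      have int: "u $ i = real_of_int \<lfloor>u $ i\<rfloor>" if "i < Suc d" for i
        using Zp(1)[OF u] that by (auto simp: integer_vecs_def)
      define y where "y = vec d (\<lambda>i. x0 i - \<lfloor>u $ i\<rfloor>)"
      have \<psi>y: "\<psi> u = vec d (\<lambda>i. real_of_int (a $ i * y $ i))"
      proof (rule eq_vecI)
        fix i assume "i < dim_vec (vec d (\<lambda>i. real_of_int (a $ i * y $ i)))"
        then have "i < d" by simp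
        then show "\<psi> u $ i = vec d (\<lambda>i. real_of_int (a $ i * y $ i)) $ i"
          using int[of i] by (simp add: \<psi>_def y_def)
      qed (simp add: \<psi>_def)
      have "real_of_int (\<Sum>i<d. a $ i * \<lfloor>u $ i\<rfloor>) = (\<Sum>i<d. real_of_int (a $ i) * u $ i)"
        unfolding of_int_sum using int by (intro sum.cong) auto
      also have "\<dots> = real_of_int (b - a $ d * \<lfloor>u $ d\<rfloor>)"
        using Zp(3)[OF u] int[of d] by simp
      finally have su: "(\<Sum>i<d. a $ i * \<lfloor>u $ i\<rfloor>) = b - a $ d * \<lfloor>u $ d\<rfloor>" by linarith
      have "(\<Sum>i<d. a $ i * y $ i) = r - (\<Sum>i<d. a $ i * \<lfloor>u $ i\<rfloor>)"
        unfolding r_def sum_subtractf[symmetric] by (intro sum.cong) (auto simp: y_def algebra_simps)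
      also have "\<dots> = a $ d * (\<lfloor>u $ d\<rfloor> - k)" unfolding su b_def by (simp add: algebra_simps)
      finally have "\<psi> u \<in> knapsack_lattice d a"
        unfolding knapsack_lattice_def \<psi>y by (intro CollectI exI[of _ y]) (auto simp: y_def)
      moreover have "\<psi> u $ i \<le> x $ i" if i: "i < d" for i
      proof -
        have "0 \<le> real_of_int (a $ i) * u $ i" using pos[of i] Zp(2)[OF u] i by simp
        then show ?thesis using frac(1)[OF i] i by (simp add: \<psi>_def algebra_simps)
      qed
      moreover have "(\<Sum>i<d. x $ i - \<psi> u $ i) \<le> \<mu>"
      proof -
        have "(\<Sum>i<d. x $ i - \<psi> u $ i) = t + (\<Sum>i<d. real_of_int (a $ i) * u $ i)"
          unfolding t_def sum.distrib[symmetric] by (intro sum.cong) (auto simp: \<psi>_def algebra_simps)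
        also have "\<dots> \<le> t + real_of_int b" using Zp(2,3)[OF u] ad by simp
        finally show ?thesis using b(1) by linarith
      qed
      ultimately show ?thesis by (simp add: covering_points_def)
    qed
    show ?thesis using pt Z(2,3) card_image[OF inj] by (intro exI[of _ "\<psi> ` Z"]) auto
  qed
  then show ?thesis
    using covers_simplex_iff[OF knapsack_lattice_carrier, of \<mu>] nonneg unfolding \<mu>_def by blast
qed

text \<open>\<open>GREATEST\<close> is meaningful only if a maximum exists. Any covering factor
  bounds the candidates from above, and -1 is a candidate because it has no representations and
  \<open>s\<close> is positive.\<close>

lemma frobenius_number_is_greatest:
  assumes a: "primitive_pos_vec (Suc d) a" and s: "0 < s" and \<mu>: "0 \<le> \<mu>"
    and cov: "covers s d (std_simplex d) (knapsack_lattice d a) \<mu>"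
  shows "card (representations a (frobenius_number s a)) < s"
    "\<And>b. frobenius_number s a < b \<Longrightarrow> s \<le> card (representations a b)"
    "-1 \<le> frobenius_number s a"
proof -
  have pos: "0 < a $ i" if "i < Suc d" for i using a that by (auto simp: primitive_pos_vec_def)
  define Q where "Q b \<longleftrightarrow> card (representations a b) < s" for b
  define M where "M = \<lceil>\<mu>\<rceil>"
  have upper: "b \<le> M" if "Q b" for b
  proof (rule ccontr)
    assume "\<not> b \<le> M"
    then have "\<mu> < real_of_int b" unfolding M_def by linarith
    moreover have "0 \<le> (\<Sum>i<Suc d. real_of_int (a $ i))"
      using pos by (intro sum_nonneg) (auto simp: less_imp_le)
    ultimately have "s \<le> card (representations a b)"
      by (intro covers_knapsack_imp_representations[OF a \<mu> cov]) linarith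
    then show False using that by (simp add: Q_def)
  qed
  have "representations a (-1) = {}"
  proof (rule equals0I)
    fix x assume "x \<in> representations a (-1)"
    then have "\<forall>i<Suc d. 0 \<le> x $ i" "(\<Sum>i<Suc d. real_of_int (a $ i) * x $ i) = -1"
      unfolding representations_iff[OF a] by auto
    moreover have "0 \<le> (\<Sum>i<Suc d. real_of_int (a $ i) * x $ i)"
      using calculation(1) pos by (intro sum_nonneg mult_nonneg_nonneg) (auto simp: less_imp_le)
    ultimately show False by simp
  qed
  then have Qm: "Q (-1)" using s by (simp add: Q_def)
  define F where "F = Max {b \<in> {-1..M}. Q b}"
  have fin: "finite {b \<in> {-1..M}. Q b}" by (rule finite_subset[of _ "{-1..M}"]) auto
  have mem: "-1 \<in> {b \<in> {-1..M}. Q b}" using Qm upper[OF Qm] by simp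
  have QF: "Q F" using Max_in[OF fin] mem unfolding F_def by blast
  have Fm: "-1 \<le> F" unfolding F_def using Max_ge[OF fin mem] .
  have Fmax: "b \<le> F" if "Q b" for b
  proof (cases "-1 \<le> b")
    case True
    then show ?thesis unfolding F_def using that upper[OF that] by (intro Max_ge fin) simp
  qed (use Fm in simp)
  have "frobenius_number s a = F" unfolding frobenius_number_def
    using QF Fmax by (intro Greatest_equality) (auto simp: Q_def)
  then show "card (representations a (frobenius_number s a)) < s"
    "\<And>b. frobenius_number s a < b \<Longrightarrow> s \<le> card (representations a b)"
    "-1 \<le> frobenius_number s a"
    using QF Fm Fmax unfolding Q_def by (auto simp: not_less[symmetric])
qed

text \<open>\<open>det H\<close> is the index of the lattice of the congruence in the integer
  lattice. Primitivity makes the residue modulo \<open>a $ d\<close> surjective, so the index is at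
  least \<open>a $ d\<close>, the direction required for the lower bound.\<close>

lemma knapsack_lattice_basis:
  assumes a: "primitive_pos_vec (Suc d) a"
  obtains H :: "int mat" where "H \<in> carrier_mat d d" "a $ d \<le> det H"
    "knapsack_lattice d a =
       lattice_of d (scale_rows d (\<lambda>i. real_of_int (a $ i)) (map_mat real_of_int H))"
proof -
  have pos: "0 < a $ i" if "i < Suc d" for i using a that by (auto simp: primitive_pos_vec_def)
  define G where "G = {y \<in> carrier_vec d. a $ d dvd (\<Sum>i<d. a $ i * y $ i)}"
  have Gc: "G \<subseteq> carrier_vec d" by (auto simp: G_def)
  have zero: "0\<^sub>v d \<in> G" by (auto simp: G_def)
  have diff: "x - y \<in> G" if "x \<in> G" "y \<in> G" for x y
  proof -
    have "(\<Sum>i<d. a $ i * (x - y) $ i) = (\<Sum>i<d. a $ i * x $ i) - (\<Sum>i<d. a $ i * y $ i)"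
      unfolding sum_subtractf[symmetric] using that by (intro sum.cong) (auto simp: G_def algebra_simps)
    then show ?thesis using that by (auto simp: G_def)
  qed
  have full: "\<exists>x\<in>G. (\<forall>k<i. x $ k = 0) \<and> x $ i > 0" if i: "i < d" for i
  proof -
    define x where "x = vec d (\<lambda>k. if k = i then a $ d else 0)"
    have "(\<Sum>k<d. a $ k * x $ k) = (\<Sum>k<d. if k = i then a $ i * a $ d else 0)"
      by (intro sum.cong) (auto simp: x_def)
    also have "\<dots> = a $ i * a $ d" using i by simp
    finally have "x \<in> G" by (simp add: G_def x_def)
    then show ?thesis using i pos[of d] by (intro bexI[of _ x]) (auto simp: x_def)
  qed
  obtain H where H: "H \<in> carrier_mat d d" and lower: "\<And>i j. i < j \<Longrightarrow> j < d \<Longrightarrow> H $$ (i,j) = 0"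
    and Hpos: "\<And>i. i < d \<Longrightarrow> H $$ (i,i) > 0" and GH: "G = {H *\<^sub>v z |z. z \<in> carrier_vec d}"
    using triangular_basis[OF Gc zero diff full] by blast
  let ?box = "\<Pi>\<^sub>E i\<in>{..<d}. {0..<H $$ (i,i)}"
  let ?f = "\<lambda>u. (\<Sum>i<d. a $ i * u i) mod a $ d"
  \<comment> \<open>The box is a full set of representatives modulo the lattice, so it meets every residue class.\<close>
  have "{0..<a $ d} \<subseteq> ?f ` ?box"
  proof
    fix r assume r: "r \<in> {0..<a $ d}"
    obtain x :: "int vec" where x: "x \<in> carrier_vec d" "a $ d dvd r - (\<Sum>i<d. a $ i * x $ i)"
      using primitive_residue_solvable[OF a] by blast
    obtain z where z: "z \<in> carrier_vec d"
      and red: "\<forall>i<d. 0 \<le> (x - H *\<^sub>v z) $ i \<and> (x - H *\<^sub>v z) $ i < H $$ (i,i)"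
      using lower_triangular_reduce[OF H lower Hpos x(1)] by blast
    define y where "y = H *\<^sub>v z"
    have y: "y \<in> carrier_vec d" "a $ d dvd (\<Sum>i<d. a $ i * y $ i)"
      using z GH unfolding y_def G_def by blast+
    define u where "u = (\<lambda>i\<in>{..<d}. (x - y) $ i)"
    have u: "u \<in> ?box" using red by (auto simp: u_def y_def)
    have "(\<Sum>i<d. a $ i * u i) = (\<Sum>i<d. a $ i * x $ i) - (\<Sum>i<d. a $ i * y $ i)"
      unfolding sum_subtractf[symmetric] using x(1) y(1)
      by (intro sum.cong) (auto simp: u_def algebra_simps)
    then have "r - (\<Sum>i<d. a $ i * u i) = (r - (\<Sum>i<d. a $ i * x $ i)) + (\<Sum>i<d. a $ i * y $ i)"
      by simp
    then have "a $ d dvd r - (\<Sum>i<d. a $ i * u i)" using dvd_add[OF x(2) y(2)] by metis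
    then have "r mod a $ d = ?f u" by (simp add: mod_eq_dvd_iff)
    then have "r = ?f u" using r by simp
    then show "r \<in> ?f ` ?box" using u by blast
  qed
  moreover have "finite ?box" by (intro finite_PiE) auto
  ultimately have "card {0..<a $ d} \<le> card ?box" by (meson surj_card_le)
  then have "nat (a $ d) \<le> (\<Prod>i<d. nat (H $$ (i,i)))" by (simp add: card_PiE)
  then have "int (nat (a $ d)) \<le> int (\<Prod>i<d. nat (H $$ (i,i)))" by (simp only: of_nat_le_iff)
  also have "int (\<Prod>i<d. nat (H $$ (i,i))) = (\<Prod>i<d. H $$ (i,i))"
    unfolding of_nat_prod using Hpos by (intro prod.cong) (auto simp: less_imp_le)
  also have "\<dots> = det H" using det_lower_triangular_prod[OF H lower] by simp
  finally have det: "a $ d \<le> det H" using pos[of d] by simp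
  have lat: "lattice_of d (map_mat real_of_int H) = map_vec real_of_int ` G"
    unfolding lattice_of_map_int[OF H] GH by blast
  have "knapsack_lattice d a = (\<lambda>y. vec d (\<lambda>i. real_of_int (a $ i * y $ i))) ` G"
    by (auto simp: knapsack_lattice_def G_def)
  also have "\<dots> = (\<lambda>y. vec d (\<lambda>i. real_of_int (a $ i) * y $ i)) ` (map_vec real_of_int ` G)"
    unfolding image_image by (intro image_cong refl eq_vecI) (auto simp: G_def)
  also have "\<dots> = lattice_of d (scale_rows d (\<lambda>i. real_of_int (a $ i)) (map_mat real_of_int H))"
    using H by (subst lattice_of_scale_rows) (auto simp: lat)
  finally show thesis using that[OF H det] by blast
qed

text \<open>Rewriting the infimum over basis matrices removes the definite description in
  \<open>lattice_det\<close>. The set is nonempty through the identity matrix and bounded below by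
  0, as covering radii are positive; this gives \<open>Inf\<close> its expected meaning.\<close>

lemma abs_inhom_minimum_props:
  assumes d: "0 < d" and s: "0 < s"
  shows "0 \<le> abs_inhom_minimum s d (std_simplex d)"
    "\<And>B. B \<in> carrier_mat d d \<Longrightarrow> det B \<noteq> 0 \<Longrightarrow>
       abs_inhom_minimum s d (std_simplex d) * \<bar>det B\<bar> powr (1 / real d)
         \<le> covering_radius s d (std_simplex d) (lattice_of d B)"
    "\<And>c. abs_inhom_minimum s d (std_simplex d) < c \<Longrightarrow>
       \<exists>B. B \<in> carrier_mat d d \<and> det B \<noteq> 0 \<and>
         covering_radius s d (std_simplex d) (lattice_of d B) < c * \<bar>det B\<bar> powr (1 / real d)"
proof -
  define Q where "Q = {covering_radius s d (std_simplex d) L / lattice_det d L powr (1 / real d) |L. is_lattice d L}"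
  define g where "g B = covering_radius s d (std_simplex d) (lattice_of d B) / \<bar>det B\<bar> powr (1 / real d)" for B
  have Q: "Q = g ` {B \<in> carrier_mat d d. det B \<noteq> 0}"
  proof (intro equalityI subsetI)
    fix q assume "q \<in> Q"
    then obtain L B where B: "is_lattice_basis d B L"
      and q: "q = covering_radius s d (std_simplex d) L / lattice_det d L powr (1 / real d)"
      unfolding Q_def is_lattice_def by blast
    have L: "lattice_of d B = L" using B by (simp add: is_lattice_basis_def lattice_of_def)
    have "q = g B" unfolding q lattice_det_eq[OF B] g_def L ..
    then show "q \<in> g ` {B \<in> carrier_mat d d. det B \<noteq> 0}" using B by (auto simp: is_lattice_basis_def)
  next
    fix q assume "q \<in> g ` {B \<in> carrier_mat d d. det B \<noteq> 0}"
    then obtain B where q: "q = g B" and B: "is_lattice_basis d B (lattice_of d B)"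
      by (auto simp: is_lattice_basis_def lattice_of_def)
    then show "q \<in> Q" unfolding Q_def is_lattice_def q g_def
      by (intro CollectI exI[of _ "lattice_of d B"]) (auto simp: lattice_det_eq[OF B])
  qed
  have inf: "abs_inhom_minimum s d (std_simplex d) = Inf Q" unfolding abs_inhom_minimum_def Q_def ..
  have "0 \<le> q" if "q \<in> Q" for q
    using that covering_radius_is_least(1)[OF _ _ d s] unfolding Q g_def
    by (auto simp: less_imp_le)
  moreover have "g (1\<^sub>m d) \<in> Q" unfolding Q by auto
  ultimately have bdd: "bdd_below Q" and ne: "Q \<noteq> {}" and nonneg: "0 \<le> Inf Q"
    by (auto intro: bdd_belowI[of _ 0] intro!: cInf_greatest)
  show "0 \<le> abs_inhom_minimum s d (std_simplex d)" using nonneg inf by simp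
  show "abs_inhom_minimum s d (std_simplex d) * \<bar>det B\<bar> powr (1 / real d)
      \<le> covering_radius s d (std_simplex d) (lattice_of d B)"
    if "B \<in> carrier_mat d d" "det B \<noteq> 0" for B
  proof -
    have "Inf Q \<le> g B" using that bdd by (intro cInf_lower) (auto simp: Q)
    then show ?thesis using that unfolding inf g_def by (simp add: pos_le_divide_eq)
  qed
  show "\<exists>B. B \<in> carrier_mat d d \<and> det B \<noteq> 0 \<and>
      covering_radius s d (std_simplex d) (lattice_of d B) < c * \<bar>det B\<bar> powr (1 / real d)"
    if less: "abs_inhom_minimum s d (std_simplex d) < c" for c
  proof -
    obtain q where "q \<in> Q" "q < c" using cInf_lessD[OF ne, of c] less inf by auto
    then obtain B where "B \<in> carrier_mat d d" "det B \<noteq> 0" "g B < c" unfolding Q by auto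
    then show ?thesis unfolding g_def by (intro exI[of _ B]) (auto simp: pos_divide_less_eq)
  qed
qed

text \<open>The second and third conclusions together are Kannan's identity: the shifted Frobenius
  number is the least covering factor of the knapsack lattice.\<close>

lemma frobenius_number_covering:
  assumes a: "primitive_pos_vec (Suc d) a" and d: "0 < d" and s: "0 < s"
  shows "-1 \<le> frobenius_number s a"
    "covers s d (std_simplex d) (knapsack_lattice d a)
       (real_of_int (frobenius_number s a) + (\<Sum>i<Suc d. real_of_int (a $ i)))"
    "\<And>\<mu>. 0 \<le> \<mu> \<Longrightarrow> covers s d (std_simplex d) (knapsack_lattice d a) \<mu> \<Longrightarrow>
       real_of_int (frobenius_number s a) + (\<Sum>i<Suc d. real_of_int (a $ i)) \<le> \<mu>"
    "0 < real_of_int (frobenius_number s a) + (\<Sum>i<Suc d. real_of_int (a $ i))"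
proof -
  have pos: "0 < a $ i" if "i < Suc d" for i using a that by (auto simp: primitive_pos_vec_def)
  obtain H where H: "H \<in> carrier_mat d d" "a $ d \<le> det H" and
    lat: "knapsack_lattice d a = lattice_of d (scale_rows d (\<lambda>i. real_of_int (a $ i)) (map_mat real_of_int H))"
    using knapsack_lattice_basis[OF a] by blast
  have "det (scale_rows d (\<lambda>i. real_of_int (a $ i)) (map_mat real_of_int H)) \<noteq> 0"
    using H pos[of d] by (auto simp: det_scale_rows dest: pos[OF less_SucI])
  \<comment> \<open>Any covering factor will do at this point: it only ensures that the Frobenius
    number exists.\<close>
  from covers_exists[OF scale_rows_carrier this d]
  obtain \<mu> where \<mu>: "0 \<le> \<mu>" "covers s d (std_simplex d) (knapsack_lattice d a) \<mu>"
    unfolding lat by (meson less_imp_le)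
  note F = frobenius_number_is_greatest[OF a s \<mu>]
  show F1: "-1 \<le> frobenius_number s a" by (rule F(3))
  \<comment> \<open>The sum of the entries is at least \<open>d + 1\<close>, hence greater than 1,
    which outweighs the possible value -1 of the Frobenius number.\<close>
  have "(\<Sum>i<Suc d. 1) \<le> (\<Sum>i<Suc d. real_of_int (a $ i))"
    using pos by (intro sum_mono) (simp add: int_one_le_iff_zero_less)
  then have "real (Suc d) \<le> (\<Sum>i<Suc d. real_of_int (a $ i))" by simp
  then show F0: "0 < real_of_int (frobenius_number s a) + (\<Sum>i<Suc d. real_of_int (a $ i))"
    using F1 d by linarith
  show "covers s d (std_simplex d) (knapsack_lattice d a)
       (real_of_int (frobenius_number s a) + (\<Sum>i<Suc d. real_of_int (a $ i)))"
    using F(2) F0 by (intro representations_imp_covers_knapsack[OF a]) auto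
  show "real_of_int (frobenius_number s a) + (\<Sum>i<Suc d. real_of_int (a $ i)) \<le> \<nu>"
    if "0 \<le> \<nu>" "covers s d (std_simplex d) (knapsack_lattice d a) \<nu>" for \<nu>
    using covers_knapsack_imp_representations[OF a that, of "frobenius_number s a"] F(1)
    by linarith
qed

lemma frobenius_number_lower_bound:
  assumes a: "primitive_pos_vec (Suc d) a" and d: "0 < d" and s: "0 < s"
  shows "abs_inhom_minimum s d (std_simplex d) * (\<Prod>i<Suc d. real_of_int (a $ i)) powr (1 / real d)
    \<le> real_of_int (frobenius_number s a) + (\<Sum>i<Suc d. real_of_int (a $ i))"
proof -
  have pos: "0 < a $ i" if "i < Suc d" for i using a that by (auto simp: primitive_pos_vec_def)
  obtain H where H: "H \<in> carrier_mat d d" "a $ d \<le> det H" and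
    lat: "knapsack_lattice d a = lattice_of d (scale_rows d (\<lambda>i. real_of_int (a $ i)) (map_mat real_of_int H))"
    using knapsack_lattice_basis[OF a] by blast
  let ?B = "scale_rows d (\<lambda>i. real_of_int (a $ i)) (map_mat real_of_int H)"
  have P: "0 < (\<Prod>i<d. real_of_int (a $ i))" using pos by (intro prod_pos) auto
  have det: "det ?B = (\<Prod>i<d. real_of_int (a $ i)) * real_of_int (det H)"
    using H by (simp add: det_scale_rows)
  have detpos: "0 < det ?B" unfolding det using P H(2) pos[of d] by (intro mult_pos_pos) auto
  have le: "(\<Prod>i<Suc d. real_of_int (a $ i)) \<le> \<bar>det ?B\<bar>"
    using detpos P H(2) unfolding det by simp
  have P0: "0 \<le> (\<Prod>i<Suc d. real_of_int (a $ i))"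
    using pos by (intro prod_nonneg) (auto simp: less_imp_le)
  \<comment> \<open>Nonnegativity of the absolute minimum allows the product to be replaced by the
    possibly larger determinant.\<close>
  have "abs_inhom_minimum s d (std_simplex d) * (\<Prod>i<Suc d. real_of_int (a $ i)) powr (1 / real d)
      \<le> abs_inhom_minimum s d (std_simplex d) * \<bar>det ?B\<bar> powr (1 / real d)"
    using abs_inhom_minimum_props(1)[OF d s] le P0 by (intro mult_left_mono powr_mono2) auto
  also have "\<dots> \<le> covering_radius s d (std_simplex d) (lattice_of d ?B)"
    using detpos by (intro abs_inhom_minimum_props(2)[OF d s]) auto
  also have "\<dots> \<le> real_of_int (frobenius_number s a) + (\<Sum>i<Suc d. real_of_int (a $ i))"
    using detpos frobenius_number_covering(2,4)[OF a d s] unfolding lat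
    by (intro covering_radius_is_least(3)[OF scale_rows_carrier _ d s]) auto
  finally show ?thesis .
qed

subsection \<open>Approximation by knapsack lattices\<close>

lemma tendsto_floor_mult_div:
  fixes N :: "nat \<Rightarrow> real"
  assumes "filterlim N at_top sequentially"
  shows "(\<lambda>k. real_of_int \<lfloor>N k * x\<rfloor> / N k) \<longlonglongrightarrow> x"
proof (rule tendsto_sandwich)
  have ev: "\<forall>\<^sub>F k in sequentially. 0 < N k"
    using assms by (auto simp: filterlim_at_top_dense)
  from ev show "\<forall>\<^sub>F k in sequentially. x - inverse (N k) \<le> real_of_int \<lfloor>N k * x\<rfloor> / N k"
  proof eventually_elim
    case (elim k)
    have "x - inverse (N k) = (N k * x - 1) / N k" using elim by (simp add: field_simps)
    also have "\<dots> \<le> real_of_int \<lfloor>N k * x\<rfloor> / N k"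
      using elim by (intro divide_right_mono) linarith+
    finally show ?case .
  qed
  from ev show "\<forall>\<^sub>F k in sequentially. real_of_int \<lfloor>N k * x\<rfloor> / N k \<le> x"
  proof eventually_elim
    case (elim k)
    have "real_of_int \<lfloor>N k * x\<rfloor> \<le> N k * x" by linarith
    then show ?case using elim by (simp add: field_simps)
  qed
  have "(\<lambda>k. inverse (N k)) \<longlonglongrightarrow> 0" by (rule tendsto_inverse_0_at_top[OF assms])
  from tendsto_diff[OF tendsto_const this] show "(\<lambda>k. x - inverse (N k)) \<longlonglongrightarrow> x" by simp
qed simp

text \<open>Dividing row \<open>i\<close> by \<open>\<alpha> i\<close> and rounding with denominator
  \<open>Suc k\<close> approximates \<open>B\<close>, so some approximation is still efficient;
  clearing the denominator is a homothety.\<close>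

lemma efficient_integer_basis:
  assumes B: "efficient_basis s d c B" and \<alpha>: "\<And>i. i < d \<Longrightarrow> 0 < \<alpha> i" and d: "0 < d"
  obtains C :: "int mat" where "C \<in> carrier_mat d d"
    "efficient_basis s d c (scale_rows d \<alpha> (map_mat real_of_int C))"
proof -
  define C where "C k = mat d d (\<lambda>(i,j). \<lfloor>real (Suc k) * (B $$ (i,j) / \<alpha> i)\<rfloor>)" for k
  define M where "M k = mat d d (\<lambda>(i,j). \<alpha> i * (real_of_int (C k $$ (i,j)) / real (Suc k)))" for k
  have lim: "(\<lambda>k. M k $$ (i,j)) \<longlonglongrightarrow> B $$ (i,j)" if ij: "i < d" "j < d" for i j
  proof -
    have "(\<lambda>k. \<alpha> i * (real_of_int \<lfloor>real (Suc k) * (B $$ (i,j) / \<alpha> i)\<rfloor> / real (Suc k)))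
        \<longlonglongrightarrow> \<alpha> i * (B $$ (i,j) / \<alpha> i)"
      by (intro tendsto_intros tendsto_floor_mult_div
          filterlim_compose[OF filterlim_real_sequentially filterlim_Suc])
    then show ?thesis using ij \<alpha>[OF ij(1)] by (simp add: M_def C_def)
  qed
  have "\<forall>\<^sub>F k in sequentially. efficient_basis s d c (M k)"
    by (rule efficient_basis_eventually[OF B _ lim]) (simp_all add: M_def)
  then obtain k where k: "efficient_basis s d c (M k)"
    using eventually_happens'[OF sequentially_bot] by blast
  have "scale_rows d (\<lambda>_. real (Suc k)) (M k) = scale_rows d \<alpha> (map_mat real_of_int (C k))"
    by (rule eq_matI) (auto simp: scale_rows_def M_def C_def)
  then show thesis using efficient_basis_scale[OF k _ d, of "real (Suc k)"] that[of "C k"]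
    by (simp add: C_def)
qed

text \<open>The Hermite form generates the same integer lattice, and diag(\<alpha>) acts from the
  left, so the real lattice is unchanged.\<close>

lemma efficient_triangular_basis:
  assumes C: "C \<in> carrier_mat d d" and \<alpha>: "\<And>i. i < d \<Longrightarrow> 0 < \<alpha> i"
    and eff: "efficient_basis s d c (scale_rows d \<alpha> (map_mat real_of_int C))"
  obtains H :: "int mat" where "H \<in> carrier_mat d d" "\<And>i j. i < j \<Longrightarrow> j < d \<Longrightarrow> H $$ (i,j) = 0"
    "\<And>i. i < d \<Longrightarrow> H $$ (i,i) > 0" "efficient_basis s d c (scale_rows d \<alpha> (map_mat real_of_int H))"
proof -
  have "det (scale_rows d \<alpha> (map_mat real_of_int C)) \<noteq> 0" using eff by (simp add: efficient_basis_def)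
  then have det: "det C \<noteq> 0" using C by (simp add: det_scale_rows)
  define G where "G = {C *\<^sub>v z |z. z \<in> carrier_vec d}"
  have Gc: "G \<subseteq> carrier_vec d" using C by (auto simp: G_def)
  have zero: "0\<^sub>v d \<in> G" unfolding G_def using C by (intro CollectI exI[of _ "0\<^sub>v d"]) (auto intro!: eq_vecI)
  have diff: "x - y \<in> G" if "x \<in> G" "y \<in> G" for x y
  proof -
    obtain z1 z2 where "z1 \<in> carrier_vec d" "z2 \<in> carrier_vec d" "x = C *\<^sub>v z1" "y = C *\<^sub>v z2"
      using \<open>x \<in> G\<close> \<open>y \<in> G\<close> by (auto simp: G_def)
    then show ?thesis unfolding G_def using mult_minus_distrib_mat_vec[OF C, of z1 z2]
      by (intro CollectI exI[of _ "z1 - z2"]) auto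
  qed
  have full: "\<exists>x\<in>G. (\<forall>k<i. x $ k = 0) \<and> x $ i > 0" if i: "i < d" for i
  proof -
    \<comment> \<open>\<open>C * adj_mat C\<close> is \<open>det C\<close> times the identity, so
      \<open>det C\<close> times a unit vector lies in \<open>G\<close>; the sign makes the entry
      positive.\<close>
    define y where "y = sgn (det C) \<cdot>\<^sub>v unit_vec d i"
    have y: "y \<in> carrier_vec d" by (simp add: y_def)
    have "C *\<^sub>v (adj_mat C *\<^sub>v y) = (C * adj_mat C) *\<^sub>v y"
      using assoc_mult_mat_vec[OF C adj_mat(1)[OF C] y] by simp
    also have "\<dots> = det C \<cdot>\<^sub>v y"
      unfolding adj_mat(2)[OF C]
    proof (rule eq_vecI)
      fix k assume "k < dim_vec (det C \<cdot>\<^sub>v y)"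
      then have k: "k < d" using y by simp
      have "((det C \<cdot>\<^sub>m 1\<^sub>m d) *\<^sub>v y) $ k = (\<Sum>j<d. (det C \<cdot>\<^sub>m 1\<^sub>m d) $$ (k,j) * y $ j)"
        using y k by (intro mult_mat_vec_nth) auto
      also have "\<dots> = (\<Sum>j<d. if j = k then det C * y $ k else 0)"
        using k by (intro sum.cong) auto
      finally show "((det C \<cdot>\<^sub>m 1\<^sub>m d) *\<^sub>v y) $ k = (det C \<cdot>\<^sub>v y) $ k" using k y by simp
    qed (use y in simp)
    finally have "det C \<cdot>\<^sub>v y \<in> G" unfolding G_def using adj_mat(1)[OF C] y
      by (intro CollectI exI[of _ "adj_mat C *\<^sub>v y"]) auto
    moreover have "(det C \<cdot>\<^sub>v y) $ i > 0" using i det by (auto simp: y_def sgn_if)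
    moreover have "(det C \<cdot>\<^sub>v y) $ k = 0" if "k < i" for k using that i by (simp add: y_def)
    ultimately show ?thesis by blast
  qed
  obtain H where H: "H \<in> carrier_mat d d" and lower: "\<And>i j. i < j \<Longrightarrow> j < d \<Longrightarrow> H $$ (i,j) = 0"
    and pos: "\<And>i. i < d \<Longrightarrow> H $$ (i,i) > 0" and GH: "G = {H *\<^sub>v z |z. z \<in> carrier_vec d}"
    using triangular_basis[OF Gc zero diff full] by blast
  have "lattice_of d (map_mat real_of_int C) = map_vec real_of_int ` G"
    unfolding lattice_of_map_int[OF C] G_def by blast
  moreover have "lattice_of d (map_mat real_of_int H) = map_vec real_of_int ` G"
    unfolding lattice_of_map_int[OF H] GH by blast
  ultimately have "lattice_of d (scale_rows d \<alpha> (map_mat real_of_int C))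
      = lattice_of d (scale_rows d \<alpha> (map_mat real_of_int H))"
    using C H by (simp add: lattice_of_scale_rows)
  moreover have "\<forall>i\<in>{..<d}. \<alpha> i \<noteq> 0" using \<alpha> by force
  moreover have "0 < (\<Prod>i<d. H $$ (i,i))" using pos by (intro prod_pos) auto
  then have "0 < det H" using det_lower_triangular_prod[OF H lower] by linarith
  then have "det H \<noteq> 0" by simp
  ultimately have "efficient_basis s d c (scale_rows d \<alpha> (map_mat real_of_int H))"
    using H by (intro efficient_basis_cong[OF eff]) (simp_all add: det_scale_rows)
  then show thesis using that H lower pos by blast
qed

text \<open>
  With $m = 2 \prod_i H_{ii}$, $T$ a power of $m$ and $w \equiv e_{d-1}$ modulo $m$, every prime factor
  of $\det A = T^d \prod_i H_{ii}$ divides $m$, while modulo $m$ the matrix $A$ reduces to its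
  subdiagonal part and hence $a_0 \equiv \pm 1$. Therefore the entries of $a$ are coprime.
\<close>

lemma triangular_approximation:
  fixes H :: "int mat" and \<alpha> :: "nat \<Rightarrow> real"
  assumes H: "H \<in> carrier_mat d d" and lower: "\<And>i j. i < j \<Longrightarrow> j < d \<Longrightarrow> H $$ (i,j) = 0"
    and pos: "\<And>i. i < d \<Longrightarrow> H $$ (i,i) > 0" and d: "0 < d"
  obtains A :: "nat \<Rightarrow> int mat" and a :: "nat \<Rightarrow> int vec" and T :: "nat \<Rightarrow> real" where
    "\<And>k. A k \<in> carrier_mat d d" "\<And>k. a k \<in> carrier_vec (Suc d)" "\<And>k. 0 < det (A k)" "\<And>k. 0 < T k"
    "\<And>k. a k $ d = det (A k)" "\<And>k. Gcd {a k $ i |i. i < Suc d} = 1"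
    "\<And>k j. j < d \<Longrightarrow> a k $ d dvd (\<Sum>i<d. a k $ i * A k $$ (i,j))"
    "\<And>i j. i < d \<Longrightarrow> j < d \<Longrightarrow> (\<lambda>k. real_of_int (A k $$ (i,j)) / T k) \<longlonglongrightarrow> real_of_int (H $$ (i,j))"
    "\<And>i. i < d \<Longrightarrow> (\<lambda>k. real_of_int (a k $ i) / real_of_int (a k $ d)) \<longlonglongrightarrow> \<alpha> i"
proof -
  define h where "h = (\<Prod>i<d. H $$ (i,i))"
  have h: "0 < h" unfolding h_def using pos by (intro prod_pos) auto
  \<comment> \<open>\<open>h\<close> divides \<open>m\<close>, and the factor 2 gives
    \<open>m > 1\<close> even for \<open>h = 1\<close>, so that the powers of \<open>m\<close> tend
    to infinity.\<close>
  define m where "m = 2 * h"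
  have m: "1 < m" using h by (simp add: m_def)
  define T where "T k = m ^ Suc k" for k
  have T: "0 < T k" for k unfolding T_def using m by simp
  have mT: "m dvd T k" for k by (simp add: T_def)
  define \<sigma> where "\<sigma> j = (\<Sum>i<d. \<alpha> i * real_of_int (H $$ (i,j)))" for j
  define A where "A k = mat d d (\<lambda>(i,j). T k * H $$ (i,j) + (if i = Suc j then 1 else 0))" for k
  \<comment> \<open>The floor is taken at scale \<open>m ^ k\<close>, one power below
    \<open>T k\<close>; the outer factor \<open>m\<close> restores the scale, so
    \<open>w k j / T k\<close> tends to \<open>\<sigma> j\<close> while its residue modulo
    \<open>m\<close> is prescribed.\<close>
  define w where "w k j = m * \<lfloor>real_of_int (m ^ k) * \<sigma> j\<rfloor> + (if Suc j = d then 1 else 0)" for k j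
  \<comment> \<open>As a row vector, the first \<open>d\<close> entries are \<open>w\<close> times
    the adjugate of \<open>A k\<close>; multiplying by \<open>A k\<close> gives
    \<open>det (A k)\<close> times \<open>w\<close>, hence divisibility by the last entry.\<close>
  define a where "a k = vec (Suc d) (\<lambda>i. if i < d then \<Sum>l<d. w k l * adj_mat (A k) $$ (l,i) else det (A k))" for k
  have A: "A k \<in> carrier_mat d d" for k by (simp add: A_def)
  have ac: "a k \<in> carrier_vec (Suc d)" for k by (simp add: a_def)
  have A_lower: "A k $$ (i,j) = 0" if "i < j" "j < d" for k i j
    using that lower[OF that] by (simp add: A_def)
  have detA: "det (A k) = T k ^ d * h" for k
  proof -
    have "det (A k) = (\<Prod>i<d. A k $$ (i,i))" using A A_lower by (rule det_lower_triangular_prod)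
    also have "\<dots> = (\<Prod>i<d. T k * H $$ (i,i))" by (intro prod.cong) (auto simp: A_def)
    finally show ?thesis by (simp add: prod.distrib h_def)
  qed
  have detpos: "0 < det (A k)" for k unfolding detA using T[of k] h by simp
  have ad: "a k $ d = det (A k)" for k by (simp add: a_def)
  have cramer: "(\<Sum>i<d. a k $ i * A k $$ (i,j)) = det (A k) * w k j" if j: "j < d" for k j
  proof -
    have entry: "(\<Sum>i<d. adj_mat (A k) $$ (l,i) * A k $$ (i,j)) = (if l = j then det (A k) else 0)"
      if l: "l < d" for l
    proof -
      have "(adj_mat (A k) * A k) $$ (l,j) = (\<Sum>i<d. adj_mat (A k) $$ (l,i) * A k $$ (i,j))"
        using A[of k] adj_mat(1)[OF A[of k]] l j
        by (auto simp: scalar_prod_def lessThan_atLeast0 intro!: sum.cong)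
      then show ?thesis using l j by (auto simp: adj_mat(3)[OF A[of k]] split: if_splits)
    qed
    have "(\<Sum>i<d. a k $ i * A k $$ (i,j)) = (\<Sum>i<d. \<Sum>l<d. w k l * (adj_mat (A k) $$ (l,i) * A k $$ (i,j)))"
      by (intro sum.cong) (auto simp: a_def sum_distrib_right mult.assoc)
    also have "\<dots> = (\<Sum>l<d. w k l * (\<Sum>i<d. adj_mat (A k) $$ (l,i) * A k $$ (i,j)))"
      by (subst sum.swap) (simp add: sum_distrib_left)
    also have "\<dots> = (\<Sum>l<d. if l = j then w k j * det (A k) else 0)"
      by (intro sum.cong) (auto simp: entry)
    finally show ?thesis using j by (simp add: mult.commute)
  qed
  have prim: "Gcd {a k $ i |i. i < Suc d} = 1" for k
  proof -
    let ?g = "Gcd {a k $ i |i. i < Suc d}"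
    have "?g dvd a k $ 0" by (rule Gcd_dvd) auto
    moreover have "?g dvd det (A k)" unfolding ad[symmetric] by (rule Gcd_dvd) auto
    then have "?g dvd m ^ (Suc k * d + 1)"
    proof (rule dvd_trans)
      have "T k ^ d * m = m ^ (Suc k * d + 1)" unfolding T_def power_mult[symmetric] by simp
      moreover have "T k ^ d * h dvd T k ^ d * m" by (simp add: m_def)
      ultimately show "det (A k) dvd m ^ (Suc k * d + 1)" unfolding detA by metis
    qed
    moreover have "coprime (a k $ 0) m"
    proof -
      define c where "c = cofactor (A k) 0 (d - 1)"
      have adj: "adj_mat (A k) $$ (l,0) = cofactor (A k) 0 l" if "l < d" for l
        using that A[of k] d by (simp add: adj_mat_def)
      \<comment> \<open>Modulo \<open>m\<close> only the last entry of \<open>w\<close> survives,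
        which leaves a single cofactor.\<close>
      have "a k $ 0 - c = (\<Sum>l<d. (w k l - (if Suc l = d then 1 else 0)) * cofactor (A k) 0 l)"
      proof -
        have "(\<Sum>l<d. (if Suc l = d then 1 else 0) * cofactor (A k) 0 l)
            = (\<Sum>l<d. if l = d - 1 then c else 0)"
          by (intro sum.cong) (auto simp: c_def)
        also have "\<dots> = c" using d by simp
        finally show ?thesis using d by (simp add: a_def adj left_diff_distrib sum_subtractf)
      qed
      moreover have "m dvd \<dots>" by (intro dvd_sum) (auto simp: w_def)
      ultimately have 1: "m dvd a k $ 0 - c" by simp
      \<comment> \<open>Deleting the first row and the last column moves the subdiagonal of ones
        onto the diagonal, and everything else is divisible by \<open>m\<close>.\<close>
      have "det (mat_delete (A k) 0 (d - 1)) mod m = det (1\<^sub>m (d - 1)) mod m"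
      proof (rule det_mod_cong)
        show "mat_delete (A k) 0 (d - 1) \<in> carrier_mat (d - 1) (d - 1)"
          using mat_delete_carrier[OF A] .
        fix i j assume ij: "i < d - 1" "j < d - 1"
        then have "mat_delete (A k) 0 (d - 1) $$ (i,j) = T k * H $$ (Suc i, j) + (if i = j then 1 else 0)"
          using A[of k] by (simp add: mat_delete_def A_def)
        then show "mat_delete (A k) 0 (d - 1) $$ (i,j) mod m = 1\<^sub>m (d - 1) $$ (i,j) mod m"
          using ij mT[of k] by (simp add: mod_eq_dvd_iff)
      qed simp
      then have "m dvd det (mat_delete (A k) 0 (d - 1)) - 1" by (simp add: mod_eq_dvd_iff)
      then have "m dvd (-1) ^ (d - 1) * (det (mat_delete (A k) 0 (d - 1)) - 1)" by (rule dvd_mult)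
      then have 2: "m dvd c - (-1) ^ (d - 1)" by (simp add: c_def cofactor_def algebra_simps)
      have 3: "m dvd a k $ 0 - (-1) ^ (d - 1)" using dvd_add[OF 1 2] by simp
      show ?thesis
      proof (rule coprimeI)
        fix p assume p: "p dvd a k $ 0" "p dvd m"
        have "p dvd a k $ 0 - (a k $ 0 - (-1) ^ (d - 1))"
          using p(1) dvd_trans[OF p(2) 3] by (rule dvd_diff)
        then show "is_unit p" by (simp add: minus_one_power_iff split: if_splits)
      qed
    qed
    then have "coprime (a k $ 0) (m ^ (Suc k * d + 1))" by (simp add: coprime_power_right_iff)
    ultimately have "is_unit ?g" by (meson coprime_common_divisor)
    \<comment> \<open>A unit could still be -1; \<open>Gcd\<close> is normalized.\<close>
    then have "normalize ?g = 1" by (rule is_unit_normalize)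
    then show ?thesis by (simp only: normalize_Gcd)
  qed
  have mlim: "filterlim (\<lambda>k. real_of_int (m ^ k)) at_top sequentially"
    using m filterlim_realpow_sequentially_gt1[of "real_of_int m"]
    by (intro filterlim_at_infinity_imp_filterlim_at_top) auto
  have Tlim: "filterlim (\<lambda>k. real_of_int (T k)) at_top sequentially"
    unfolding T_def by (rule filterlim_compose[OF mlim filterlim_Suc])
  have const_lim: "(\<lambda>k. c / real_of_int (T k)) \<longlonglongrightarrow> 0" for c
    by (rule real_tendsto_divide_at_top[OF tendsto_const Tlim])
  have Alim: "(\<lambda>k. real_of_int (A k $$ (i,j)) / real_of_int (T k)) \<longlonglongrightarrow> real_of_int (H $$ (i,j))"
    if "i < d" "j < d" for i j
  proof -
    have "(\<lambda>k. real_of_int (H $$ (i,j)) + (if i = Suc j then 1 else 0) / real_of_int (T k))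
        \<longlonglongrightarrow> real_of_int (H $$ (i,j)) + 0"
      by (intro tendsto_add tendsto_const const_lim)
    moreover have "real_of_int (A k $$ (i,j)) / real_of_int (T k)
        = real_of_int (H $$ (i,j)) + (if i = Suc j then 1 else 0) / real_of_int (T k)" for k
      using that T[of k] by (simp add: A_def add_divide_distrib)
    ultimately show ?thesis by simp
  qed
  have wlim: "(\<lambda>k. real_of_int (w k j) / real_of_int (T k)) \<longlonglongrightarrow> \<sigma> j" for j
  proof -
    have "(\<lambda>k. real_of_int \<lfloor>real_of_int (m ^ k) * \<sigma> j\<rfloor> / real_of_int (m ^ k)
        + (if Suc j = d then 1 else 0) / real_of_int (T k)) \<longlonglongrightarrow> \<sigma> j + 0"
      by (intro tendsto_add const_lim tendsto_floor_mult_div mlim)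
    moreover have "real_of_int (w k j) / real_of_int (T k)
        = real_of_int \<lfloor>real_of_int (m ^ k) * \<sigma> j\<rfloor> / real_of_int (m ^ k)
          + (if Suc j = d then 1 else 0) / real_of_int (T k)" for k
      using m by (simp add: w_def T_def add_divide_distrib)
    ultimately show ?thesis by simp
  qed
  define \<rho> where "\<rho> k i = real_of_int (a k $ i) / real_of_int (a k $ d)" for k i
  have split: "(\<Sum>i<d. f i) = f j + (\<Sum>i\<in>{j<..<d}. f i)"
    if "\<And>i. i < j \<Longrightarrow> f i = 0" "j < d" for f :: "nat \<Rightarrow> real" and j
  proof -
    have "(\<Sum>i<d. f i) = (\<Sum>i\<in>insert j {j<..<d}. f i)"
      using that by (intro sum.mono_neutral_right) (auto simp: not_less le_less)
    then show ?thesis by simp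
  qed
  \<comment> \<open>Back substitution in the upper triangular system for \<open>\<rho>\<close> gives its limit from the last index down.\<close>
  have \<rho>_eq: "\<rho> k j = (real_of_int (w k j) / real_of_int (T k)
      - (\<Sum>i\<in>{j<..<d}. \<rho> k i * (real_of_int (A k $$ (i,j)) / real_of_int (T k)))) / real_of_int (H $$ (j,j))"
    if j: "j < d" for k j
  proof -
    have "(\<Sum>i<d. \<rho> k i * (real_of_int (A k $$ (i,j)) / real_of_int (T k)))
        = real_of_int (\<Sum>i<d. a k $ i * A k $$ (i,j)) / real_of_int (det (A k)) / real_of_int (T k)"
      by (simp add: \<rho>_def ad sum_divide_distrib)
    also have "\<dots> = real_of_int (w k j) / real_of_int (T k)"
      unfolding cramer[OF j] using detpos[of k] by simp
    finally have "\<rho> k j * (real_of_int (A k $$ (j,j)) / real_of_int (T k))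
        + (\<Sum>i\<in>{j<..<d}. \<rho> k i * (real_of_int (A k $$ (i,j)) / real_of_int (T k)))
        = real_of_int (w k j) / real_of_int (T k)"
      using split[of j "\<lambda>i. \<rho> k i * (real_of_int (A k $$ (i,j)) / real_of_int (T k))"] A_lower[OF _ j] j
      by simp
    moreover have "real_of_int (A k $$ (j,j)) / real_of_int (T k) = real_of_int (H $$ (j,j))"
      using j T[of k] by (simp add: A_def)
    ultimately show ?thesis using pos[OF j] by (simp add: field_simps)
  qed
  have \<rho>lim: "(\<lambda>k. \<rho> k j) \<longlonglongrightarrow> \<alpha> j" if "j < d" for j
    using that
  proof (induction "d - j" arbitrary: j rule: less_induct)
    case less
    have "\<sigma> j = \<alpha> j * real_of_int (H $$ (j,j)) + (\<Sum>i\<in>{j<..<d}. \<alpha> i * real_of_int (H $$ (i,j)))"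
      unfolding \<sigma>_def using lower[OF _ less.prems] less.prems by (intro split) auto
    then have *: "\<alpha> j = (\<sigma> j - (\<Sum>i\<in>{j<..<d}. \<alpha> i * real_of_int (H $$ (i,j)))) / real_of_int (H $$ (j,j))"
      using pos[OF less.prems] by (simp add: field_simps)
    show ?case
      unfolding \<rho>_eq[OF less.prems] by (subst *, intro tendsto_divide tendsto_diff wlim tendsto_sum tendsto_mult tendsto_const)
        (use less pos[OF less.prems] in \<open>auto intro!: Alim less.hyps\<close>)
  qed
  show thesis
    by (rule that[of A a "\<lambda>k. real_of_int (T k)"])
      (use A ac detpos T ad prim cramer Alim \<rho>lim in \<open>auto simp: \<rho>_def\<close>)
qed

text \<open>The matrices \<open>M k\<close> normalize the candidate lattices so that they converge
  to an efficient basis. Openness then yields one index at which efficiency, positivity and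
  closeness of the ratios hold together.\<close>

lemma frobenius_number_approximation:
  fixes \<alpha> :: "nat \<Rightarrow> real"
  assumes d: "0 < d" and s: "0 < s" and \<epsilon>: "0 < \<epsilon>" and \<alpha>: "\<And>i. i < d \<Longrightarrow> 0 < \<alpha> i"
    and c: "abs_inhom_minimum s d (std_simplex d) < c"
  obtains a where "primitive_pos_vec (Suc d) a"
    "\<And>i. i < d \<Longrightarrow> \<bar>\<alpha> i - real_of_int (a $ i) / real_of_int (a $ d)\<bar> < \<epsilon>"
    "real_of_int (frobenius_number s a) + (\<Sum>i<Suc d. real_of_int (a $ i))
       < c * (\<Prod>i<Suc d. real_of_int (a $ i)) powr (1 / real d)"
proof -
  obtain B where B: "B \<in> carrier_mat d d" "det B \<noteq> 0"
    "covering_radius s d (std_simplex d) (lattice_of d B) < c * \<bar>det B\<bar> powr (1 / real d)"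
    using abs_inhom_minimum_props(3)[OF d s c] by blast
  have effB: "efficient_basis s d c B"
    using B covering_radius_is_least[OF B(1,2) d s] unfolding efficient_basis_def by blast
  obtain C :: "int mat" where C: "C \<in> carrier_mat d d"
    "efficient_basis s d c (scale_rows d \<alpha> (map_mat real_of_int C))"
    using efficient_integer_basis[where \<alpha> = \<alpha>, OF effB \<alpha> d] by blast
  obtain H :: "int mat" where H: "H \<in> carrier_mat d d" "\<And>i j. i < j \<Longrightarrow> j < d \<Longrightarrow> H $$ (i,j) = 0"
    "\<And>i. i < d \<Longrightarrow> H $$ (i,i) > 0"
    and effH: "efficient_basis s d c (scale_rows d \<alpha> (map_mat real_of_int H))"
    using efficient_triangular_basis[where \<alpha> = \<alpha>, OF C(1) \<alpha> C(2)] by blast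
  obtain A :: "nat \<Rightarrow> int mat" and a :: "nat \<Rightarrow> int vec" and T :: "nat \<Rightarrow> real" where
    A: "\<And>k. A k \<in> carrier_mat d d" and ac: "\<And>k. a k \<in> carrier_vec (Suc d)"
    and detpos: "\<And>k. 0 < det (A k)" and T: "\<And>k. 0 < T k"
    and ad: "\<And>k. a k $ d = det (A k)" and prim: "\<And>k. Gcd {a k $ i |i. i < Suc d} = 1"
    and dvd: "\<And>k j. j < d \<Longrightarrow> a k $ d dvd (\<Sum>i<d. a k $ i * A k $$ (i,j))"
    and Alim: "\<And>i j. i < d \<Longrightarrow> j < d \<Longrightarrow> (\<lambda>k. real_of_int (A k $$ (i,j)) / T k) \<longlonglongrightarrow> real_of_int (H $$ (i,j))"
    and alim: "\<And>i. i < d \<Longrightarrow> (\<lambda>k. real_of_int (a k $ i) / real_of_int (a k $ d)) \<longlonglongrightarrow> \<alpha> i"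
    using triangular_approximation[OF H d, of \<alpha>] by blast
  define M where "M k = mat d d (\<lambda>(i,j).
    real_of_int (a k $ i) / real_of_int (a k $ d) * (real_of_int (A k $$ (i,j)) / T k))" for k
  have ev1: "\<forall>\<^sub>F k in sequentially. efficient_basis s d c (M k)"
  proof (rule efficient_basis_eventually[OF effH])
    fix i j assume ij: "i < d" "j < d"
    show "(\<lambda>k. M k $$ (i,j)) \<longlonglongrightarrow> scale_rows d \<alpha> (map_mat real_of_int H) $$ (i,j)"
      using tendsto_mult[OF alim[OF ij(1)] Alim[OF ij]] ij H(1) by (simp add: M_def scale_rows_def)
  qed (simp add: M_def)
  have "\<forall>\<^sub>F k in sequentially. 0 < real_of_int (a k $ i) / real_of_int (a k $ d) \<and>
      \<bar>\<alpha> i - real_of_int (a k $ i) / real_of_int (a k $ d)\<bar> < \<epsilon>" if i: "i < d" for i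
  proof (rule eventually_conj)
    show "\<forall>\<^sub>F k in sequentially. 0 < real_of_int (a k $ i) / real_of_int (a k $ d)"
      using alim[OF i] \<alpha>[OF i] by (rule order_tendstoD)
    show "\<forall>\<^sub>F k in sequentially. \<bar>\<alpha> i - real_of_int (a k $ i) / real_of_int (a k $ d)\<bar> < \<epsilon>"
      using tendstoD[OF alim[OF i] \<epsilon>] by (simp add: dist_real_def abs_minus_commute)
  qed
  then have ev2: "\<forall>\<^sub>F k in sequentially. \<forall>i\<in>{..<d}. 0 < real_of_int (a k $ i) / real_of_int (a k $ d) \<and>
      \<bar>\<alpha> i - real_of_int (a k $ i) / real_of_int (a k $ d)\<bar> < \<epsilon>"
    by (intro eventually_ball_finite) auto
  obtain k where effM: "efficient_basis s d c (M k)"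
    and near: "\<And>i. i < d \<Longrightarrow> 0 < real_of_int (a k $ i) / real_of_int (a k $ d) \<and>
      \<bar>\<alpha> i - real_of_int (a k $ i) / real_of_int (a k $ d)\<bar> < \<epsilon>"
    using eventually_happens'[OF sequentially_bot eventually_conj[OF ev1 ev2]] by auto
  have ad0: "0 < a k $ d" using detpos[of k] by (simp add: ad)
  have pos: "0 < a k $ i" if "i < Suc d" for i
    using that near[of i] ad0 by (cases "i = d") (auto simp: zero_less_divide_iff)
  have pp: "primitive_pos_vec (Suc d) (a k)" using ac prim pos by (simp add: primitive_pos_vec_def)
  let ?N = "scale_rows d (\<lambda>i. real_of_int (a k $ i)) (map_mat real_of_int (A k))"
  \<comment> \<open>Clearing both denominators of \<open>M k\<close> is a homothety, so efficiency
    passes to the integer matrix \<open>?N\<close>.\<close>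
  have "scale_rows d (\<lambda>_. real_of_int (a k $ d) * T k) (M k) = ?N"
    using A[of k] T[of k] ad0 by (intro eq_matI) (auto simp: scale_rows_def M_def)
  then have "efficient_basis s d c ?N"
    using efficient_basis_scale[OF effM _ d, of "real_of_int (a k $ d) * T k"] T[of k] ad0 by simp
  then obtain \<mu> where \<mu>: "0 < \<mu>" "covers s d (std_simplex d) (lattice_of d ?N) \<mu>"
    "\<mu> < c * \<bar>det ?N\<bar> powr (1 / real d)"
    unfolding efficient_basis_def by blast
  \<comment> \<open>Integer combinations of the columns of \<open>A k\<close> satisfy the congruence
    because \<open>a k $ d\<close> divides every entry of the row vector \<open>a k\<close> times
    \<open>A k\<close>.\<close>
  have "lattice_of d ?N \<subseteq> knapsack_lattice d (a k)"
  proof -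
    have Ac: "map_mat real_of_int (A k) \<in> carrier_mat d d" using A[of k] by simp
    have "vec d (\<lambda>i. real_of_int (a k $ i) * map_vec real_of_int (A k *\<^sub>v z) $ i) \<in> knapsack_lattice d (a k)"
      if z: "z \<in> carrier_vec d" for z
    proof -
      define y where "y = A k *\<^sub>v z"
      have y: "y \<in> carrier_vec d" using A[of k] z by (simp add: y_def)
      have "(\<Sum>i<d. a k $ i * y $ i) = (\<Sum>i<d. \<Sum>j<d. a k $ i * A k $$ (i,j) * z $ j)"
        using mult_mat_vec_nth[OF A z, of _ k] unfolding y_def
        by (intro sum.cong) (auto simp: sum_distrib_left mult.assoc simp del: index_mult_mat_vec)
      also have "\<dots> = (\<Sum>j<d. (\<Sum>i<d. a k $ i * A k $$ (i,j)) * z $ j)"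
        by (subst sum.swap) (simp add: sum_distrib_right)
      also have "a k $ d dvd \<dots>" by (rule dvd_sum) (rule dvd_mult2[OF dvd], simp)
      finally have "a k $ d dvd (\<Sum>i<d. a k $ i * y $ i)" .
      moreover have "vec d (\<lambda>i. real_of_int (a k $ i) * map_vec real_of_int y $ i)
          = vec d (\<lambda>i. real_of_int (a k $ i * y $ i))"
        using y by (intro eq_vecI) auto
      ultimately show ?thesis using y unfolding knapsack_lattice_def y_def by blast
    qed
    then show ?thesis unfolding lattice_of_scale_rows[OF Ac] lattice_of_map_int[OF A] by blast
  qed
  then have "covers s d (std_simplex d) (knapsack_lattice d (a k)) \<mu>"
    using \<mu>(1) by (intro covers_mono[OF \<mu>(2) _ knapsack_lattice_carrier]) auto
  then have "real_of_int (frobenius_number s (a k)) + (\<Sum>i<Suc d. real_of_int (a k $ i)) \<le> \<mu>"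
    using \<mu>(1) by (intro frobenius_number_covering(3)[OF pp d s]) auto
  also have "\<mu> < c * \<bar>det ?N\<bar> powr (1 / real d)" by (rule \<mu>(3))
  \<comment> \<open>The last entry of \<open>a k\<close> is \<open>det (A k)\<close>, so the
    sublattice has exactly the full product as its determinant and the bound loses nothing.\<close>
  also have "det ?N = (\<Prod>i<Suc d. real_of_int (a k $ i))"
    using A[of k] by (simp add: det_scale_rows ad)
  also have "\<bar>\<Prod>i<Suc d. real_of_int (a k $ i)\<bar> = (\<Prod>i<Suc d. real_of_int (a k $ i))"
    using pos by (intro abs_of_nonneg prod_nonneg) (auto simp: less_imp_le)
  finally show thesis using that[OF pp] near by blast
qed

theorem theorem1p1:
  fixes n s :: nat
  assumes "n \<ge> 3" and "s \<ge> 1"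
  shows
    "(\<forall>a :: int vec. primitive_pos_vec n a \<longrightarrow>
        real_of_int (frobenius_number s a) \<ge>
          abs_inhom_minimum s (n - 1) (std_simplex (n - 1))
            * (\<Prod>i<n. real_of_int (a $ i)) powr (1 / (real n - 1))
          - (\<Sum>i<n. real_of_int (a $ i)))
     \<and>
     (\<forall>\<epsilon> :: real. \<forall>\<alpha> :: real vec.
        \<epsilon> > 0 \<longrightarrow> \<alpha> \<in> carrier_vec (n - 1) \<longrightarrow>
        0 < \<alpha> $ 0 \<longrightarrow> (\<forall>i j. i \<le> j \<longrightarrow> j < n - 1 \<longrightarrow> \<alpha> $ i \<le> \<alpha> $ j) \<longrightarrow>
        (\<exists>a :: int vec. primitive_pos_vec n a \<and>
           (\<forall>i<n - 1. \<bar>\<alpha> $ i - real_of_int (a $ i) / real_of_int (a $ (n - 1))\<bar> < \<epsilon>) \<and>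
           (real_of_int (frobenius_number s a) + (\<Sum>i<n. real_of_int (a $ i)))
             / (\<Prod>i<n. real_of_int (a $ i)) powr (1 / (real n - 1))
           < abs_inhom_minimum s (n - 1) (std_simplex (n - 1)) + \<epsilon>))"
proof -
  define d where "d = n - 1"
  have n: "n = Suc d" and n1: "n - 1 = d" and rn: "real n - 1 = real d" and d: "0 < d" and s: "0 < s"
    using assms by (auto simp: d_def)
  show ?thesis unfolding n1 rn
  proof (intro conjI allI impI)
    fix a assume "primitive_pos_vec n a"
    then show "real_of_int (frobenius_number s a) \<ge>
        abs_inhom_minimum s d (std_simplex d) * (\<Prod>i<n. real_of_int (a $ i)) powr (1 / real d)
          - (\<Sum>i<n. real_of_int (a $ i))"
      using frobenius_number_lower_bound[of d a s] d s unfolding n by linarith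
  next
    fix \<epsilon> :: real and \<alpha> :: "real vec"
    assume \<epsilon>: "0 < \<epsilon>" and \<alpha>: "0 < \<alpha> $ 0" "\<forall>i j. i \<le> j \<longrightarrow> j < d \<longrightarrow> \<alpha> $ i \<le> \<alpha> $ j"
    have \<alpha>pos: "0 < \<alpha> $ i" if "i < d" for i using \<alpha> that by (meson less_le_trans zero_le)
    obtain a where a: "primitive_pos_vec (Suc d) a"
      "\<And>i. i < d \<Longrightarrow> \<bar>\<alpha> $ i - real_of_int (a $ i) / real_of_int (a $ d)\<bar> < \<epsilon>"
      "real_of_int (frobenius_number s a) + (\<Sum>i<Suc d. real_of_int (a $ i))
        < (abs_inhom_minimum s d (std_simplex d) + \<epsilon>) * (\<Prod>i<Suc d. real_of_int (a $ i)) powr (1 / real d)"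
      using frobenius_number_approximation[where \<alpha> = "\<lambda>i. \<alpha> $ i"
          and c = "abs_inhom_minimum s d (std_simplex d) + \<epsilon>", OF d s \<epsilon> \<alpha>pos] \<epsilon>
      by auto
    have "0 < (\<Prod>i<Suc d. real_of_int (a $ i))"
      using a(1) by (intro prod_pos) (auto simp: primitive_pos_vec_def)
    then have "0 < (\<Prod>i<Suc d. real_of_int (a $ i)) powr (1 / real d)"
      unfolding powr_gt_zero by (rule less_imp_neq[symmetric])
    then show "\<exists>a. primitive_pos_vec n a \<and>
        (\<forall>i<d. \<bar>\<alpha> $ i - real_of_int (a $ i) / real_of_int (a $ d)\<bar> < \<epsilon>) \<and>
        (real_of_int (frobenius_number s a) + (\<Sum>i<n. real_of_int (a $ i)))
          / (\<Prod>i<n. real_of_int (a $ i)) powr (1 / real d)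
        < abs_inhom_minimum s d (std_simplex d) + \<epsilon>"
      using a unfolding n by (intro exI[of _ a]) (simp add: pos_divide_less_eq del: sum.lessThan_Suc prod.lessThan_Suc)
  qed
qed

end
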